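(* The following holds for rotational 2D reflection symmetric $(-\alpha)$-homogeneous solutions $u=(u^{1},u^{2},0)$, with $r^{2\alpha}p=\mathrm{const.}$, of the stationary incompressible Euler equations. (i) For $0\leq\alpha\leq 1$, no such solutions $u\in C^{1}(\mathbb{R}^{2}\setminus\{0\})$ exist. (ii) For $-1\leq\alpha<0$, no such solutions $u\in C^{2}(\mathbb{R}^{2}\setminus\{0\})$ exist. (iii) For every $\alpha>1$, such solutions $u\in C^{2}(\mathbb{R}^{2}\setminus\{0\})$ exist. (iv) For every $\alpha<-1$, such solutions $u\in C^{1}(\mathbb{R}^{2}\setminus\{0\})\cap C(\mathbb{R}^{2})$ (in the distributional sense in $\mathbb{R}^2$) exist.
   Context: The Euler equations are $u\cdot\nabla u+\nabla p=0$, $\nabla\cdot u=0$. Here $u=(u^1,u^2,0)$ and $p$ depend only on $(x_1,x_2)$, so this is the 2D stationary Euler system for $(u^1,u^2)$; $(r,\phi)$ are polar coordinates in the $(x_1,x_2)$-plane. A pair $(u,p)$ is a $(-\alpha)$-homogeneous solution ($\alpha\in\mathbb{R}$) if it solves the equations and, for all $\lambda>0$, $u(x)=\lambda^{\alpha}u(\lambda x)$ and $p(x)=\lambda^{2\alpha}p(\lambda x)$. Solutions in $C^1(\mathbb{R}^2\setminus\{0\})$ or $C^2(\mathbb{R}^2\setminus\{0\})$ satisfy the equations classically in $\mathbb{R}^2\setminus\{0\}$; solutions in $C(\mathbb{R}^2)$, considered for $\alpha<0$, satisfy them in $\mathbb{R}^2$ in the distributional sense. 2D reflection symmetric means $u^{1}(x_1,x_2)=u^{1}(x_1,-x_2)$,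 $u^{2}(x_1,x_2)=-u^{2}(x_1,-x_2)$, $p(x_1,x_2)=p(x_1,-x_2)$. A solution is irrotational if $\omega=\partial_1u^2-\partial_2u^1$ vanishes identically, and rotational otherwise. *)

theory Defs
  imports "HOL-Analysis.Analysis"
begin

definition partial_deriv :: "'n::finite \<Rightarrow> (real ^ 'n \<Rightarrow> real) \<Rightarrow> real ^ 'n \<Rightarrow> real" where
  "partial_deriv i f x = frechet_derivative f (at x) (axis i 1)"

text \<open>\<open>C^k(S)\<close>. Only meaningful for open \<open>S\<close>, since derivatives are taken in the whole space.\<close>

primrec Ck_on :: "nat \<Rightarrow> 'a::euclidean_space set \<Rightarrow> ('a \<Rightarrow> 'b::real_normed_vector) \<Rightarrow> bool" where
  "Ck_on 0 S f \<longleftrightarrow> continuous_on S f"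
| "Ck_on (Suc k) S f \<longleftrightarrow>
     (\<forall>x\<in>S. f differentiable (at x)) \<and>
     (\<forall>v. Ck_on k S (\<lambda>x. frechet_derivative f (at x) v))"

definition test_function :: "(real ^ 2 \<Rightarrow> real) \<Rightarrow> bool" where
  "test_function \<zeta> \<longleftrightarrow> (\<forall>k. Ck_on k UNIV \<zeta>) \<and> compact (closure {x. \<zeta> x \<noteq> 0})"

abbreviation punctured_plane :: "(real ^ 2) set" where
  "punctured_plane \<equiv> UNIV - {0}"

text \<open>A velocity field \<open>(u\<^sup>1, u\<^sup>2, 0)\<close> depending only on \<open>(x\<^sub>1, x\<^sub>2)\<close> is represented by the
  planar field \<open>(u\<^sup>1, u\<^sup>2)\<close>.\<close>

definition classical_euler_on ::
    "(real ^ 2) set \<Rightarrow> (real ^ 2 \<Rightarrow> real ^ 2) \<Rightarrow> (real ^ 2 \<Rightarrow> real) \<Rightarrow> bool" where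
  "classical_euler_on S u p \<longleftrightarrow>
     (\<forall>x\<in>S. u differentiable (at x) \<and> p differentiable (at x) \<and>
        (\<forall>j. (\<Sum>i\<in>UNIV. u x $ i * partial_deriv i (\<lambda>y. u y $ j) x) + partial_deriv j p x = 0) \<and>
        (\<Sum>i\<in>UNIV. partial_deriv i (\<lambda>y. u y $ i) x) = 0)"

text \<open>For merely continuous \<open>u\<close> with \<open>\<nabla> \<cdot> u = 0\<close>, the distribution \<open>u \<cdot> \<nabla>u\<close> is
  \<open>\<nabla> \<cdot> (u \<otimes> u)\<close>. Continuity of \<open>u\<close> and \<open>p\<close> makes all integrands below integrable.\<close>

definition distributional_euler ::
    "(real ^ 2 \<Rightarrow> real ^ 2) \<Rightarrow> (real ^ 2 \<Rightarrow> real) \<Rightarrow> bool" where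
  "distributional_euler u p \<longleftrightarrow>
     continuous_on UNIV u \<and> continuous_on UNIV p \<and>
     (\<forall>\<zeta>. test_function \<zeta> \<longrightarrow>
        (\<forall>j. (\<integral>x. (\<Sum>i\<in>UNIV. u x $ i * u x $ j * partial_deriv i \<zeta> x)
                 + p x * partial_deriv j \<zeta> x \<partial>lborel) = 0) \<and>
        (\<integral>x. (\<Sum>i\<in>UNIV. u x $ i * partial_deriv i \<zeta> x) \<partial>lborel) = 0)"

definition homogeneous_on ::
    "real \<Rightarrow> (real ^ 2) set \<Rightarrow> (real ^ 2 \<Rightarrow> real ^ 2) \<Rightarrow> (real ^ 2 \<Rightarrow> real) \<Rightarrow> bool" where
  "homogeneous_on \<alpha> S u p \<longleftrightarrow>
     (\<forall>x\<in>S. \<forall>l>0. u x = (l powr \<alpha>) *\<^sub>R u (l *\<^sub>R x) \<and> p x = l powr (2 * \<alpha>) * p (l *\<^sub>R x))"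

definition reflect :: "real ^ 2 \<Rightarrow> real ^ 2" where
  "reflect x = vector [x $ 1, - x $ 2]"

definition reflection_symmetric_on ::
    "(real ^ 2) set \<Rightarrow> (real ^ 2 \<Rightarrow> real ^ 2) \<Rightarrow> (real ^ 2 \<Rightarrow> real) \<Rightarrow> bool" where
  "reflection_symmetric_on S u p \<longleftrightarrow>
     (\<forall>x\<in>S. u x $ 1 = u (reflect x) $ 1 \<and> u x $ 2 = - u (reflect x) $ 2 \<and> p x = p (reflect x))"

definition vorticity :: "(real ^ 2 \<Rightarrow> real ^ 2) \<Rightarrow> real ^ 2 \<Rightarrow> real" where
  "vorticity u x = partial_deriv 1 (\<lambda>y. u y $ 2) x - partial_deriv 2 (\<lambda>y. u y $ 1) x"

text \<open>The vorticity is evaluated off the origin only, where all fields considered are \<open>C^1\<close>.\<close>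

definition irrotational :: "(real ^ 2 \<Rightarrow> real ^ 2) \<Rightarrow> bool" where
  "irrotational u \<longleftrightarrow> (\<forall>x\<in>punctured_plane. vorticity u x = 0)"

abbreviation rotational :: "(real ^ 2 \<Rightarrow> real ^ 2) \<Rightarrow> bool" where
  "rotational u \<equiv> \<not> irrotational u"

definition scaled_pressure_const :: "real \<Rightarrow> (real ^ 2 \<Rightarrow> real) \<Rightarrow> bool" where
  "scaled_pressure_const \<alpha> p \<longleftrightarrow>
     (\<exists>c. \<forall>x\<in>punctured_plane. norm x powr (2 * \<alpha>) * p x = c)"

text \<open>The properties, apart from solving the equations and regularity, required of a solution
  with domain \<open>S\<close> (the plane or the punctured plane).\<close>

definition admissible_on ::
    "real \<Rightarrow> (real ^ 2) set \<Rightarrow> (real ^ 2 \<Rightarrow> real ^ 2) \<Rightarrow> (real ^ 2 \<Rightarrow> real) \<Rightarrow> bool" where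
  "admissible_on \<alpha> S u p \<longleftrightarrow>
     homogeneous_on \<alpha> S u p \<and> reflection_symmetric_on S u p \<and>
     rotational u \<and> scaled_pressure_const \<alpha> p"

end

theory Submission
  imports Defs
begin

text \<open>In polar coordinates write \<open>u = r powr (-\<alpha>) * (U e\<^sub>r + V e\<^sub>\<phi>)\<close> and \<open>p = c * r powr (-2\<alpha>)\<close>. The Euler equations
  become \<open>V' = (\<alpha> - 1) U\<close> and \<open>V U' = \<alpha> U\<^sup>2 + V\<^sup>2 + 2 \<alpha> c\<close>, and the vorticity on the unit circle is
  \<open>W = (1 - \<alpha>) V - U'\<close>. With the Bernoulli function \<open>Q = U\<^sup>2 + V\<^sup>2 + 2 c\<close> one has \<open>V W = - \<alpha> Q\<close> and
  \<open>Q' = - 2 U W\<close>, so \<open>Q |V| powr (2\<alpha> / (1 - \<alpha>))\<close> is constant wherever \<open>V \<noteq> 0\<close>. Reflection symmetry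
  gives \<open>V 0 = 0\<close>.

  For \<open>-1 < \<alpha> < 1\<close> the constant, which is \<open>|W| |V|\<close> to a positive power up to a factor, tends to
  zero at the nearest zero of \<open>V\<close>, so \<open>W = 0\<close>. For \<open>\<alpha> = 1\<close> one gets \<open>V = 0\<close> and \<open>U\<close> constant. For \<open>\<alpha> = -1\<close>
  the same computation gives \<open>V W' = 0\<close>; if \<open>u\<close> is \<open>C\<^sup>2\<close> then \<open>W'\<close> is continuous, hence \<open>W\<close> is constant,
  and it vanishes at \<open>0\<close> by symmetry.

  For \<open>|\<alpha>| > 1\<close> eliminating \<open>U\<close> leads to a conservative oscillator
  \<open>V'\<^sup>2 = \<nu>\<^sup>2 (1 - V\<^sup>2) + D (1 - |V| powr m)\<close> with \<open>\<nu> = |\<alpha> - 1|\<close> and \<open>m = 2\<alpha> / (\<alpha> - 1) > 1\<close>. Its frequency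
  ranges from \<open>\<nu>\<close> to infinity as \<open>D\<close> grows, so some \<open>D > 0\<close> yields an integer frequency. The solution \<open>V\<close>
  is \<open>C\<^sup>2\<close>, and \<open>C\<^sup>3\<close> if \<open>m > 2\<close>, that is, if \<open>\<alpha> > 1\<close>. For \<open>\<alpha> < -1\<close> the field and the pressure have homogeneity
  degree above 1, so they are \<open>C\<^sup>1\<close> across the origin and solve the equations there as well.\<close>

subsection \<open>Polar frame in the plane\<close>

text \<open>Rotation by a right angle, so that \<open>circ t\<close> and
  \<open>perp (circ t)\<close> are the polar unit vectors \<open>e\<^sub>r\<close> and
  \<open>e\<^sub>\<phi>\<close>.\<close>

definition perp :: "real ^ 2 \<Rightarrow> real ^ 2" where
  "perp x = vector [- x $ 2, x $ 1]"

definition circ :: "real \<Rightarrow> real ^ 2" where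
  "circ t = vector [cos t, sin t]"

lemma perp_nth [simp]: "perp x $ 1 = - x $ 2" "perp x $ 2 = x $ 1"
  by (simp_all add: perp_def)

lemma circ_nth [simp]: "circ t $ 1 = cos t" "circ t $ 2 = sin t"
  by (simp_all add: circ_def)

lemma reflect_nth [simp]: "reflect x $ 1 = x $ 1" "reflect x $ 2 = - x $ 2"
  by (simp_all add: reflect_def)

lemma inner_real2: "x \<bullet> y = x $ 1 * y $ 1 + x $ 2 * (y $ 2 :: real)" for x y :: "real ^ 2"
  by (simp add: inner_vec_def sum_2)

lemma norm_real2: "(norm x)\<^sup>2 = (x $ 1)\<^sup>2 + (x $ 2)\<^sup>2" for x :: "real ^ 2"
  unfolding power2_norm_eq_inner by (simp add: inner_real2 power2_eq_square)

lemma vec_eq_real2: "x = y \<longleftrightarrow> x $ 1 = y $ 1 \<and> x $ 2 = y $ 2" for x y :: "real ^ 2"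
  by (simp add: vec_eq_iff forall_2)

lemma axis_real2 [simp]:
  "axis 1 (1::real) $ (1::2) = 1" "axis 1 (1::real) $ (2::2) = 0"
  "axis 2 (1::real) $ (1::2) = 0" "axis 2 (1::real) $ (2::2) = 1"
  by (simp_all add: axis_def)

lemma norm_circ [simp]: "norm (circ t) = 1"
proof -
  have "(norm (circ t))\<^sup>2 = 1" by (simp add: norm_real2)
  then show ?thesis using norm_ge_zero[of "circ t"] by (simp add: power2_eq_1_iff)
qed

lemma circ_nonzero [simp]: "circ t \<noteq> 0"
  using norm_circ[of t] by fastforce

lemma linear_real2:
  fixes D :: "real ^ 2 \<Rightarrow> 'b::real_vector"
  assumes "linear D"
  shows "D v = v $ 1 *\<^sub>R D (axis 1 1) + v $ 2 *\<^sub>R D (axis 2 1)"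
proof -
  have "v = v $ 1 *\<^sub>R axis 1 1 + v $ 2 *\<^sub>R axis 2 1"
    by (simp add: vec_eq_real2)
  then have "D v = D (v $ 1 *\<^sub>R axis 1 1 + v $ 2 *\<^sub>R axis 2 1)" by simp
  then show ?thesis
    by (simp only: linear_add[OF assms] linear_scale[OF assms])
qed

lemma partial_deriv_component:
  assumes "(u has_derivative D) (at x)"
  shows "partial_deriv i (\<lambda>y. u y $ j) x = D (axis i 1) $ j"
proof -
  have "((\<lambda>y. u y $ j) has_derivative (\<lambda>h. D h $ j)) (at x)"
    by (rule bounded_linear.has_derivative[OF bounded_linear_vec_nth assms])
  then show ?thesis
    unfolding partial_deriv_def by (metis frechet_derivative_at)
qed

lemma partial_deriv_eq:
  assumes "(f has_derivative D) (at x)"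
  shows "partial_deriv i f x = D (axis i 1)"
  using assms unfolding partial_deriv_def by (metis frechet_derivative_at)

lemma vorticity_eq:
  assumes "(u has_derivative D) (at x)"
  shows "vorticity u x = D (axis 1 1) $ 2 - D (axis 2 1) $ 1"
  unfolding vorticity_def partial_deriv_component[OF assms] ..

text \<open>By linearity the convective sum of partial derivatives is the single value
  \<open>Du x (u x)\<close>. The equations can then be checked with whatever derivatives are at
  hand.\<close>

lemma classical_euler_on_iff:
  assumes "\<And>x. x \<in> S \<Longrightarrow> (u has_derivative Du x) (at x)"
    and "\<And>x. x \<in> S \<Longrightarrow> (p has_derivative Dp x) (at x)"
  shows "classical_euler_on S u p \<longleftrightarrow>
    (\<forall>x\<in>S. (\<forall>j. Du x (u x) $ j + Dp x (axis j 1) = 0) \<and>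
       Du x (axis 1 1) $ 1 + Du x (axis 2 1) $ 2 = 0)"
proof -
  have "Du x (u x) $ j = u x $ 1 * Du x (axis 1 1) $ j + u x $ 2 * Du x (axis 2 1) $ j"
    if "x \<in> S" for x j
    using linear_real2[OF has_derivative_linear[OF assms(1)[OF that]], of "u x"] by simp
  moreover have "u differentiable (at x)" "p differentiable (at x)" if "x \<in> S" for x
    using assms that differentiableI by blast+
  ultimately show ?thesis
    unfolding classical_euler_on_def
    by (simp add: sum_2 partial_deriv_component[OF assms(1)] partial_deriv_eq[OF assms(2)])
qed

lemma has_vector_derivative_circ: "(circ has_vector_derivative perp (circ t)) (at t within S)"
proof -
  have c: "circ = (\<lambda>t. cos t *\<^sub>R axis 1 1 + sin t *\<^sub>R axis 2 1)"
    by (auto simp: vec_eq_real2)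
  have p: "perp (circ t) = - sin t *\<^sub>R axis 1 1 + cos t *\<^sub>R axis 2 1"
    by (simp add: vec_eq_real2)
  show ?thesis
    unfolding p by (subst c) (auto intro!: derivative_eq_intros)
qed

lemma perp_circ: "perp (circ t) = circ (t + pi / 2)"
  by (simp add: vec_eq_real2 cos_add sin_add)

lemma continuous_on_circ: "continuous_on S circ"
  using has_vector_derivative_circ
  by (meson continuous_on_eq_continuous_within has_vector_derivative_continuous)

lemma has_vector_derivative_perp_circ:
  "((\<lambda>t. perp (circ t)) has_vector_derivative - circ t) (at t)"
proof -
  have "((\<lambda>t. circ (t + pi / 2)) has_vector_derivative 1 *\<^sub>R perp (circ (t + pi / 2))) (at t)"
    by (rule vector_diff_chain_at[of "\<lambda>t. t + pi / 2", unfolded o_def])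
       (auto intro!: derivative_eq_intros has_vector_derivative_circ)
  moreover have "perp (circ (t + pi / 2)) = - circ t"
    by (simp add: vec_eq_real2 cos_add sin_add)
  ultimately show ?thesis by (simp add: perp_circ)
qed

section \<open>Derivatives of homogeneous maps\<close>

text \<open>Euler's identity: the curve \<open>l \<mapsto> u (l *\<^sub>R x)\<close> is
  differentiated at \<open>l = 1\<close> once by the chain rule and once by homogeneity.\<close>

lemma homogeneous_derivative:
  fixes u :: "'a::real_normed_vector \<Rightarrow> 'b::real_normed_vector"
  assumes D: "(u has_derivative D) (at x)"
    and hom: "\<And>l. l > 0 \<Longrightarrow> u (l *\<^sub>R x) = l powr a *\<^sub>R u x"
  shows "D x = a *\<^sub>R u x"
proof -
  have "((\<lambda>l. l *\<^sub>R x) has_vector_derivative x) (at 1)"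
    by (auto intro!: derivative_eq_intros)
  then have "((\<lambda>l. u (l *\<^sub>R x)) has_vector_derivative D x) (at 1)"
    using vector_derivative_diff_chain_within[of "\<lambda>l. l *\<^sub>R x" x 1 UNIV u D] D
    by (simp add: o_def has_derivative_at_withinI)
  moreover have "((\<lambda>l. l powr a *\<^sub>R u x) has_vector_derivative a *\<^sub>R u x) (at 1)"
    by (auto intro!: derivative_eq_intros)
  then have "((\<lambda>l. u (l *\<^sub>R x)) has_vector_derivative a *\<^sub>R u x) (at 1)"
    by (rule has_vector_derivative_transform_within_open[of _ _ _ "{0<..}"]) (auto simp: hom)
  ultimately show ?thesis by (rule vector_derivative_unique_at)
qed

text \<open>Differentiating both sides of the scaling law shows that a derivative is homogeneous of
  one degree less. The open set \<open>S\<close> allows for laws known only away from the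
  origin.\<close>

lemma homogeneous_derivative_scale:
  fixes u :: "'a::real_normed_vector \<Rightarrow> 'b::real_normed_vector"
  assumes D: "(u has_derivative D) (at x)" and E: "(u has_derivative E) (at (l *\<^sub>R x))"
    and S: "open S" "x \<in> S"
    and l: "l > 0" and hom: "\<And>y. y \<in> S \<Longrightarrow> u (l *\<^sub>R y) = l powr a *\<^sub>R u y"
  shows "E v = l powr (a - 1) *\<^sub>R D v"
proof -
  have "((\<lambda>y. u (l *\<^sub>R y)) has_derivative (\<lambda>h. E (l *\<^sub>R h))) (at x)"
    by (rule has_derivative_compose[where f = "\<lambda>y. l *\<^sub>R y" and f' = "\<lambda>h. l *\<^sub>R h", OF _ E])
       (auto intro!: derivative_eq_intros)
  moreover have "((\<lambda>y. u (l *\<^sub>R y)) has_derivative (\<lambda>h. l powr a *\<^sub>R D h)) (at x)"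
    by (rule has_derivative_transform_within_open[OF has_derivative_scaleR_right[OF D] S])
       (simp add: hom)
  ultimately have "E (l *\<^sub>R v) = l powr a *\<^sub>R D v"
    by (metis has_derivative_unique)
  then have "l *\<^sub>R E v = l powr a *\<^sub>R D v"
    using linear_scale[OF has_derivative_linear[OF E]] by simp
  then have "inverse l *\<^sub>R (l *\<^sub>R E v) = inverse l *\<^sub>R (l powr a *\<^sub>R D v)" by simp
  then show ?thesis using l by (simp add: powr_diff divide_inverse mult.commute)
qed

text \<open>The range excludes \<open>0\<close> and includes \<open>2 * pi\<close> because the
  rigidity argument treats positive angles; the angle \<open>0\<close> is traded for a full
  turn.\<close>

lemma polar_decomposition:
  obtains r t where "x = r *\<^sub>R circ t" "r = norm x" "0 < t" "t \<le> 2 * pi"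
proof -
  obtain t where t: "0 \<le> t" "t < 2 * pi" "Complex (x $ 1) (x $ 2) = rcis (norm x) t"
  proof -
    have "norm x = cmod (Complex (x $ 1) (x $ 2))"
      using norm_real2[of x] by (simp add: cmod_def real_sqrt_unique)
    then show ?thesis
      using that[of "Arg2pi (Complex (x $ 1) (x $ 2))"] Arg2pi[of "Complex (x $ 1) (x $ 2)"]
      by (auto simp: rcis_def cis_conv_exp is_Arg_def)
  qed
  have "x = norm x *\<^sub>R circ t"
    using t(3) by (simp add: complex_eq_iff vec_eq_real2)
  moreover have "circ (t + 2 * pi) = circ t" by (simp add: vec_eq_real2)
  ultimately show ?thesis
    using that[of "norm x" t] that[of "norm x" "t + 2 * pi"] t by (cases "t = 0") auto
qed

subsection \<open>Functions of class \<open>C^k\<close>\<close>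

lemma Ck_on_Suc_has_derivative:
  assumes "Ck_on (Suc k) S f" "x \<in> S"
  shows "(f has_derivative frechet_derivative f (at x)) (at x)"
  by (rule frechet_derivative_works[THEN iffD1]) (use assms in simp)

lemma Ck_on_cong:
  assumes "Ck_on k S f" "open S" "\<And>x. x \<in> S \<Longrightarrow> f x = g x"
  shows "Ck_on k S g"
  using assms(1,3)
proof (induction k arbitrary: f g)
  case 0
  then show ?case using continuous_on_eq by (auto simp del: continuous_on_eq_continuous_at)
next
  case (Suc k)
  have d: "f differentiable (at x)" if "x \<in> S" for x
    using Suc.prems(1) that by simp
  have "g differentiable (at x)" if "x \<in> S" for x
    by (rule differentiableI, rule has_derivative_transform_within_open
          [OF Ck_on_Suc_has_derivative[OF Suc.prems(1) that] assms(2) that Suc.prems(2)])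
  moreover have "Ck_on k S (\<lambda>x. frechet_derivative g (at x) v)" for v
  proof (rule Suc.IH)
    show "Ck_on k S (\<lambda>x. frechet_derivative f (at x) v)" using Suc.prems(1) by simp
    show "frechet_derivative f (at x) v = frechet_derivative g (at x) v" if "x \<in> S" for x
      using frechet_derivative_transform_within_open[OF d[OF that] assms(2) that Suc.prems(2)] by simp
  qed
  ultimately show ?case by simp
qed

text \<open>An explicitly computed derivative may replace \<open>frechet_derivative\<close>: the two
  agree on \<open>S\<close>, and on an open set regularity depends only on the values there.\<close>

lemma Ck_on_SucI:
  assumes "open S" "\<And>x. x \<in> S \<Longrightarrow> (f has_derivative D x) (at x)"
    and "\<And>v. Ck_on k S (\<lambda>x. D x v)"
  shows "Ck_on (Suc k) S f"
proof -
  have "frechet_derivative f (at x) = D x" if "x \<in> S" for x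
    using frechet_derivative_at[OF assms(2)[OF that]] by simp
  then have "Ck_on k S (\<lambda>x. frechet_derivative f (at x) v)" for v
    by (intro Ck_on_cong[OF assms(3)[of v] assms(1)]) simp
  moreover have "f differentiable (at x)" if "x \<in> S" for x
    using assms(2)[OF that] differentiableI by blast
  ultimately show ?thesis by simp
qed

lemma Ck_on_Suc_imp: "Ck_on (Suc k) S f \<Longrightarrow> Ck_on k S f"
proof (induction k arbitrary: f)
  case 0
  then show ?case
    by (auto intro!: continuous_at_imp_continuous_on differentiable_imp_continuous_within)
next
  case (Suc k)
  then have "Ck_on k S (\<lambda>x. frechet_derivative f (at x) v)" for v by simp
  with Suc.prems show ?case by simp
qed

lemma Ck_on_le: "Ck_on n S f \<Longrightarrow> k \<le> n \<Longrightarrow> Ck_on k S f"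
proof (induction n)
  case (Suc n)
  then show ?case by (metis Ck_on_Suc_imp le_Suc_eq)
qed simp

lemma Ck_on_const: "Ck_on k S (\<lambda>_. c)"
proof (induction k arbitrary: c)
  case (Suc k)
  have "frechet_derivative (\<lambda>_. c) (at x) = (\<lambda>_. 0)" for x :: 'a
    by (rule frechet_derivative_const)
  then show ?case using Suc.IH by simp
qed simp

lemma Ck_on_bounded_linear:
  assumes "bounded_linear L" "open S"
  shows "Ck_on k S L"
proof (cases k)
  case 0
  then show ?thesis using linear_continuous_on[OF assms(1)] by simp
next
  case (Suc n)
  show ?thesis unfolding Suc
    by (rule Ck_on_SucI[OF assms(2) bounded_linear_imp_has_derivative[OF assms(1)] Ck_on_const])
qed

lemma Ck_on_add:
  assumes "Ck_on k S f" "Ck_on k S g" "open S"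
  shows "Ck_on k S (\<lambda>x. f x + g x)"
  using assms(1,2)
proof (induction k arbitrary: f g)
  case 0
  then show ?case by (simp add: continuous_on_add)
next
  case (Suc k)
  show ?case
  proof (rule Ck_on_SucI[OF assms(3)])
    show "((\<lambda>x. f x + g x) has_derivative (\<lambda>v. frechet_derivative f (at x) v + frechet_derivative g (at x) v)) (at x)"
      if "x \<in> S" for x
      by (intro has_derivative_add Ck_on_Suc_has_derivative[OF Suc.prems(1) that]
          Ck_on_Suc_has_derivative[OF Suc.prems(2) that])
    show "Ck_on k S (\<lambda>x. frechet_derivative f (at x) v + frechet_derivative g (at x) v)" for v
      using Suc.prems by (intro Suc.IH) auto
  qed
qed

lemma Ck_on_bilinear:
  assumes "bounded_bilinear B" "Ck_on k S f" "Ck_on k S g" "open S"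
  shows "Ck_on k S (\<lambda>x. B (f x) (g x))"
  using assms(2,3)
proof (induction k arbitrary: f g)
  case 0
  then show ?case using bounded_bilinear.continuous_on[OF assms(1)] by simp
next
  case (Suc k)
  show ?case
  proof (rule Ck_on_SucI[OF assms(4)])
    show "((\<lambda>x. B (f x) (g x)) has_derivative
        (\<lambda>v. B (f x) (frechet_derivative g (at x) v) + B (frechet_derivative f (at x) v) (g x))) (at x)"
      if "x \<in> S" for x
      by (rule bounded_bilinear.FDERIV[OF assms(1)]
          Ck_on_Suc_has_derivative[OF Suc.prems(1) that]
          Ck_on_Suc_has_derivative[OF Suc.prems(2) that])+
    show "Ck_on k S (\<lambda>x. B (f x) (frechet_derivative g (at x) v) + B (frechet_derivative f (at x) v) (g x))" for v
      \<comment> \<open>Each summand of the product rule keeps one factor undifferentiated, and that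
        factor is weakened to class \<open>C^k\<close>.\<close>
      using Suc.prems Suc.prems[THEN Ck_on_Suc_imp] by (intro Ck_on_add Suc.IH assms(4)) auto
  qed
qed

lemmas Ck_on_mult = Ck_on_bilinear[OF bounded_bilinear_mult]
lemmas Ck_on_scaleR = Ck_on_bilinear[OF bounded_bilinear_scaleR]

lemma has_derivative_norm_powr:
  fixes x :: "'a::real_inner"
  assumes "x \<noteq> 0"
  shows "((\<lambda>x. norm x powr s) has_derivative (\<lambda>v. s * norm x powr (s - 2) * (x \<bullet> v))) (at x)"
proof -
  have "norm x powr (s - 2) = norm x powr s / (norm x)\<^sup>2"
    using assms by (simp add: powr_diff)
  moreover have "(norm has_derivative (\<lambda>h. h \<bullet> sgn x)) (at x)"
    using has_derivative_norm[OF assms] .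
  ultimately show ?thesis
    using assms
    by (auto intro!: derivative_eq_intros simp: fun_eq_iff sgn_div_norm field_simps inner_commute power2_eq_square)
qed

text \<open>The exponent stays arbitrary in the induction, since the derivative is a power with
  exponent \<open>s - 2\<close> times a linear function of \<open>x\<close>.\<close>

lemma Ck_on_norm_powr:
  "Ck_on k (UNIV - {0}) (\<lambda>x::'a::euclidean_space. norm x powr s)"
proof (induction k arbitrary: s)
  case 0
  then show ?case by (auto intro!: continuous_intros)
next
  case (Suc k)
  show ?case
  proof (rule Ck_on_SucI)
    show "((\<lambda>x. norm x powr s) has_derivative (\<lambda>v. s * norm x powr (s - 2) * (x \<bullet> v))) (at x)"
      if "x \<in> UNIV - {0}" for x :: 'a
      using has_derivative_norm_powr that by blast
    show "Ck_on k (UNIV - {0}) (\<lambda>x. s * norm x powr (s - 2) * (x \<bullet> v))" for v :: 'a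
      by (intro Ck_on_mult Ck_on_const Suc.IH Ck_on_bounded_linear bounded_linear_inner_left open_delete open_UNIV)
  qed auto
qed

lemma Ck_on_Suc_real:
  fixes f f' :: "real \<Rightarrow> real"
  assumes "\<And>t. (f has_real_derivative f' t) (at t)" "Ck_on k UNIV f'"
  shows "Ck_on (Suc k) UNIV f"
proof (rule Ck_on_SucI)
  show "(f has_derivative (\<lambda>v. f' t * v)) (at t)" for t
    using assms(1) by (simp add: has_field_derivative_def)
  show "Ck_on k UNIV (\<lambda>t. f' t * v)" for v
    by (intro Ck_on_mult assms(2) Ck_on_const open_UNIV)
qed auto

lemma Ck_on_1_has_derivative:
  assumes "Ck_on 1 S f" "x \<in> S"
  shows "(f has_derivative frechet_derivative f (at x)) (at x)"
  using assms Ck_on_Suc_has_derivative[of 0 S f x] unfolding One_nat_def by blast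

subsection \<open>Periodic functions of the polar angle\<close>

text \<open>An arbitrary, possibly discontinuous choice of polar angle. It is harmless because it is
  only used inside functions of period \<open>2 * pi\<close>, for which every choice gives the same
  value.\<close>

definition angle :: "real ^ 2 \<Rightarrow> real" where
  "angle x = (SOME t. x = norm x *\<^sub>R circ t)"

lemma angle: "x = norm x *\<^sub>R circ (angle x)"
proof -
  have "\<exists>t. x = norm x *\<^sub>R circ t" by (metis polar_decomposition)
  then show ?thesis unfolding angle_def by (rule someI_ex)
qed

lemma periodic_int:
  fixes g :: "real \<Rightarrow> 'a"
  assumes "\<And>t. g (t + 2 * pi) = g t"
  shows "g (t + 2 * pi * of_int n) = g t"
proof -
  have nat: "g (t + 2 * pi * of_nat k) = g t" for t k
  proof (induction k)
    case (Suc k)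
    have "g (t + 2 * pi * of_nat (Suc k)) = g ((t + 2 * pi * of_nat k) + 2 * pi)"
      by (simp add: algebra_simps)
    then show ?case by (simp add: assms Suc)
  qed simp
  show ?thesis
  proof (cases n)
    case (nonneg k)
    then show ?thesis using nat by simp
  next
    case (neg k)
    have "g (t + 2 * pi * of_int n) = g ((t + 2 * pi * of_int n) + 2 * pi * of_nat (Suc k))"
      by (rule nat[symmetric])
    also have "(t + 2 * pi * of_int n) + 2 * pi * of_nat (Suc k) = t"
      unfolding neg by (simp add: algebra_simps)
    finally show ?thesis .
  qed
qed

lemma periodic_angle:
  fixes g :: "real \<Rightarrow> 'a"
  assumes g: "\<And>t. g (t + 2 * pi) = g t" and y: "y = r *\<^sub>R circ t" "r > 0"
  shows "g (angle y) = g t"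
proof -
  have "norm y = r" using y by simp
  then have "r *\<^sub>R circ (angle y) = r *\<^sub>R circ t" using angle[of y] y by simp
  then have "circ (angle y) = circ t" using y(2) by simp
  then have "sin (angle y) = sin t \<and> cos (angle y) = cos t"
    by (simp add: vec_eq_real2)
  then obtain n :: int where "angle y = t + 2 * pi * of_int n"
    by (metis sin_cos_eq_iff)
  then show ?thesis using periodic_int[of g, OF g] by simp
qed

lemma bounded_linear_perp: "bounded_linear perp"
  by (rule linear_conv_bounded_linear[THEN iffD1], rule linearI) (simp_all add: vec_eq_real2)

lemma inner_perp_self [simp]: "perp x \<bullet> x = 0" "x \<bullet> perp x = 0"
  by (simp_all add: inner_real2)

text \<open>Near \<open>x\<close> a smooth branch of the angle of \<open>y\<close> is the angle of \<open>x\<close> plus the arctangent of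
  the slope of \<open>y\<close> in the frame \<open>(x, perp x)\<close>.\<close>

lemma angle_branch:
  assumes x: "x \<noteq> 0"
  obtains f where "(f has_derivative (\<lambda>v. norm x powr - 2 * (perp x \<bullet> v))) (at x)" "f x = angle x"
    "\<And>y. y \<bullet> x > 0 \<Longrightarrow> \<exists>r>0. y = r *\<^sub>R circ (f y)"
proof -
  define f where "f y = angle x + arctan ((y \<bullet> perp x) / (y \<bullet> x))" for y
  have xx: "x \<bullet> x = (norm x)\<^sup>2" by (simp add: power2_norm_eq_inner)
  have N: "norm x powr - 2 = 1 / (norm x)\<^sup>2"
    using x by (simp add: powr_minus divide_simps)
  have "((\<lambda>y. arctan ((y \<bullet> perp x) / (y \<bullet> x))) has_derivative (\<lambda>v. norm x powr - 2 * (perp x \<bullet> v))) (at x)"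
    using x unfolding N
    by (auto intro!: derivative_eq_intros simp: fun_eq_iff xx inner_commute field_simps)
  from has_derivative_add[OF has_derivative_const this, of "angle x"]
  have df: "(f has_derivative (\<lambda>v. norm x powr - 2 * (perp x \<bullet> v))) (at x)"
    unfolding f_def by simp
  have fx: "f x = angle x" by (simp add: f_def)
  have "\<exists>r>0. y = r *\<^sub>R circ (f y)" if "y \<bullet> x > 0" for y
  proof -
    define t where "t = (y \<bullet> perp x) / (y \<bullet> x)"
    define C where "C = cos (arctan t)"
    have C: "C > 0" unfolding C_def using arctan_lbound arctan_ubound by (intro cos_gt_zero_pi)
    have S: "sin (arctan t) = t * C"
      using tan_arctan[of t] C unfolding tan_def C_def by (simp add: field_simps)
    \<comment> \<open>The radius is forced: the component of \<open>y\<close> along the direction of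
      \<open>x\<close> has to equal \<open>r * cos (arctan t)\<close>.\<close>
    define r where "r = (y \<bullet> x) / (norm x * C)"
    have r: "r > 0" using that x C by (simp add: r_def)
    have "circ (f y) = C *\<^sub>R (circ (angle x) + t *\<^sub>R perp (circ (angle x)))"
      by (simp add: f_def t_def[symmetric] vec_eq_real2 cos_add sin_add S C_def[symmetric] algebra_simps)
    then have "r *\<^sub>R circ (f y) = ((y \<bullet> x) / norm x) *\<^sub>R circ (angle x) + ((y \<bullet> perp x) / norm x) *\<^sub>R perp (circ (angle x))"
      using C that by (simp add: r_def t_def algebra_simps)
    also have "circ (angle x) = (1 / norm x) *\<^sub>R x"
      using angle[of x] x by (metis scaleR_one divide_inverse_commute mult.right_neutral norm_eq_zero right_inverse scaleR_scaleR mult.left_neutral mult.commute)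
    also have "((y \<bullet> x) / norm x) *\<^sub>R (1 / norm x) *\<^sub>R x + ((y \<bullet> perp x) / norm x) *\<^sub>R perp ((1 / norm x) *\<^sub>R x)
        = (1 / (norm x)\<^sup>2) *\<^sub>R ((y \<bullet> x) *\<^sub>R x + (y \<bullet> perp x) *\<^sub>R perp x)"
      by (simp add: vec_eq_real2 power2_eq_square algebra_simps)
    \<comment> \<open>Expansion of \<open>y\<close> in the orthogonal frame \<open>x\<close>,
      \<open>perp x\<close>, whose vectors both have length \<open>norm x\<close>.\<close>
    also have "(y \<bullet> x) *\<^sub>R x + (y \<bullet> perp x) *\<^sub>R perp x = (norm x)\<^sup>2 *\<^sub>R y"
      unfolding norm_real2 by (simp add: vec_eq_real2 inner_real2 power2_eq_square algebra_simps)
    finally have "y = r *\<^sub>R circ (f y)" using x by simp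
    with r show ?thesis by blast
  qed
  with df fx show ?thesis by (rule that)
qed

text \<open>On the half plane around \<open>x\<close> the smooth branch and the chosen angle differ
  by multiples of \<open>2 * pi\<close>, which a periodic \<open>g\<close> does not see. Regularity
  of \<open>g \<circ> angle\<close> can then be read off from the branch.\<close>

lemma periodic_angle_branch:
  fixes g :: "real \<Rightarrow> 'a"
  assumes g: "\<And>t. g (t + 2 * pi) = g t" and x: "x \<noteq> 0"
  obtains f S where "(f has_derivative (\<lambda>v. norm x powr - 2 * (perp x \<bullet> v))) (at x)" "f x = angle x"
    "open S" "x \<in> S" "\<And>y. y \<in> S \<Longrightarrow> g (f y) = g (angle y)"
proof -
  obtain f where f: "(f has_derivative (\<lambda>v. norm x powr - 2 * (perp x \<bullet> v))) (at x)" "f x = angle x"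
    "\<And>y. y \<bullet> x > 0 \<Longrightarrow> \<exists>r>0. y = r *\<^sub>R circ (f y)"
    using angle_branch[OF x] by blast
  have "g (f y) = g (angle y)" if "y \<in> {y. y \<bullet> x > 0}" for y
  proof -
    obtain r where "r > 0" "y = r *\<^sub>R circ (f y)" using f(3) \<open>y \<in> _\<close> by blast
    then show ?thesis using periodic_angle[of g y r "f y", OF g] by simp
  qed
  moreover have "open {y. y \<bullet> x > 0}"
    by (intro open_Collect_less continuous_intros)
  ultimately show ?thesis using that[OF f(1,2), of "{y. y \<bullet> x > 0}"] x by simp
qed

lemma has_derivative_periodic_angle:
  fixes g :: "real \<Rightarrow> real"
  assumes g: "\<And>t. g (t + 2 * pi) = g t" and dg: "(g has_real_derivative g') (at (angle x))"
    and x: "x \<noteq> 0"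
  shows "((\<lambda>y. g (angle y)) has_derivative (\<lambda>v. g' * (norm x powr - 2 * (perp x \<bullet> v)))) (at x)"
proof -
  obtain f S where f: "(f has_derivative (\<lambda>v. norm x powr - 2 * (perp x \<bullet> v))) (at x)" "f x = angle x"
    "open S" "x \<in> S" "\<And>y. y \<in> S \<Longrightarrow> g (f y) = g (angle y)"
    using periodic_angle_branch[of g, OF g x] by blast
  have "((\<lambda>y. g (f y)) has_derivative (\<lambda>v. g' * (norm x powr - 2 * (perp x \<bullet> v)))) (at x)"
    using has_derivative_compose[OF f(1), of g "(*) g'"] dg f(2)
    by (simp add: has_field_derivative_def)
  then show ?thesis
    by (rule has_derivative_transform_within_open[OF _ f(3,4,5)])
qed

text \<open>Induction over all periodic \<open>g\<close> at once: the derivative of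
  \<open>g \<circ> angle\<close> is \<open>g' \<circ> angle\<close> times a smooth factor, and
  \<open>g'\<close> is again periodic and one class less regular.\<close>

lemma Ck_on_periodic_angle:
  fixes g :: "real \<Rightarrow> real"
  assumes "Ck_on k UNIV g" "\<And>t. g (t + 2 * pi) = g t"
  shows "Ck_on k punctured_plane (\<lambda>x. g (angle x))"
  using assms
proof (induction k arbitrary: g)
  case 0
  show ?case
    unfolding Ck_on.simps
  proof (rule continuous_at_imp_continuous_on, rule ballI)
    fix x :: "real ^ 2" assume "x \<in> punctured_plane"
    then obtain f S where f: "(f has_derivative (\<lambda>v. norm x powr - 2 * (perp x \<bullet> v))) (at x)"
      "open S" "x \<in> S" "\<And>y. y \<in> S \<Longrightarrow> g (f y) = g (angle y)"
      using periodic_angle_branch[of g x, OF 0(2)] by blast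
    have "isCont (\<lambda>y. g (f y)) x"
      using 0(1) has_derivative_continuous[OF f(1)]
      by (intro isCont_o2[of x f g]) (auto simp: continuous_on_eq_continuous_at)
    moreover have "eventually (\<lambda>y. g (f y) = g (angle y)) (nhds x)"
      using eventually_nhds_in_open[OF f(2,3)] by eventually_elim (rule f(4))
    from isCont_cong[OF this] have "isCont (\<lambda>y. g (f y)) x = isCont (\<lambda>y. g (angle y)) x" .
    ultimately show "isCont (\<lambda>y. g (angle y)) x" by simp
  qed
next
  case (Suc k)
  define g' where "g' t = frechet_derivative g (at t) 1" for t
  have dg: "(g has_real_derivative g' t) (at t)" for t
  proof -
    have d: "(g has_derivative frechet_derivative g (at t)) (at t)"
      using Ck_on_Suc_has_derivative[OF Suc.prems(1), of t] by simp
    have "frechet_derivative g (at t) v = g' t * v" for v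
      using linear_scale[OF has_derivative_linear[OF d], of v 1] by (simp add: g'_def mult.commute)
    then have "frechet_derivative g (at t) = (*) (g' t)" by blast
    with d show ?thesis by (simp add: has_field_derivative_def)
  qed
  have g'_per: "g' (t + 2 * pi) = g' t" for t
  proof -
    have "((\<lambda>t. g (t + 2 * pi)) has_real_derivative g' (t + 2 * pi)) (at t)"
      using DERIV_shift[of g "g' (t + 2 * pi)" t "2 * pi"] dg by simp
    then show ?thesis unfolding Suc.prems(2) using dg DERIV_unique by blast
  qed
  have Ck: "Ck_on k UNIV g'" using Suc.prems(1) unfolding g'_def[abs_def] by simp
  show ?case
  proof (rule Ck_on_SucI)
    show "((\<lambda>y. g (angle y)) has_derivative (\<lambda>v. g' (angle x) * (norm x powr - 2 * (perp x \<bullet> v)))) (at x)"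
      if "x \<in> punctured_plane" for x
      using that by (intro has_derivative_periodic_angle Suc.prems(2) dg) auto
    have "Ck_on k punctured_plane (\<lambda>x. perp x \<bullet> v)" for v
      by (rule Ck_on_bounded_linear)
         (auto intro!: bounded_linear_compose[OF bounded_linear_inner_left bounded_linear_perp])
    then show "Ck_on k punctured_plane (\<lambda>x. g' (angle x) * (norm x powr - 2 * (perp x \<bullet> v)))" for v
      by (intro Ck_on_mult Suc.IH Ck g'_per Ck_on_norm_powr) auto
  qed auto
qed

subsection \<open>Rigidity for \<open>|\<alpha>| \<le> 1\<close>\<close>

text \<open>The conserved quantity is followed from \<open>t\<close> back to the last zero of
  \<open>V\<close> before \<open>t\<close>. There its expression through \<open>W\<close> and a
  positive power of \<open>\<bar>V\<bar>\<close> tends to zero, because \<open>W\<close> stays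
  bounded.\<close>

lemma vanishing_of_weighted_vorticity:
  fixes U V U' :: "real \<Rightarrow> real"
  assumes dU: "\<And>t. (U has_real_derivative U' t) (at t)"
    and dV: "\<And>t. (V has_real_derivative (\<alpha> - 1) * U t) (at t)"
    and eq: "\<And>t. V t * U' t = \<alpha> * (U t)\<^sup>2 + (V t)\<^sup>2 + 2 * \<alpha> * c"
    and contU': "continuous_on UNIV U'"
    and \<alpha>: "- 1 < \<alpha>" "\<alpha> < 1" and V0: "V 0 = 0" and t: "0 < t" "V t \<noteq> 0"
  shows "U' t = (1 - \<alpha>) * V t"
proof -
  have contV: "continuous_on S V" for S
    using dV by (meson DERIV_isCont continuous_at_imp_continuous_on)
  define W where "W s = (1 - \<alpha>) * V s - U' s" for s
  define Q where "Q s = (U s)\<^sup>2 + (V s)\<^sup>2 + 2 * c" for s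
  have VW: "V s * W s = - \<alpha> * Q s" for s
    using eq[of s] by (simp add: W_def Q_def algebra_simps power2_eq_square)
  \<comment> \<open>The exponent solves \<open>e * (\<alpha> - 1) = - \<alpha>\<close>, which makes
    the two terms of the derivative of \<open>Z\<close> cancel. The base
    \<open>(V s)\<^sup>2\<close> is positive for either sign of \<open>V\<close>.\<close>
  define e where "e = \<alpha> / (1 - \<alpha>)"
  define Z where "Z s = Q s * ((V s)\<^sup>2 powr e)" for s
  have dZ: "(Z has_real_derivative 0) (at s)" if "V s \<noteq> 0" for s
  proof -
    have dQ: "(Q has_real_derivative - 2 * U s * W s) (at s)"
      unfolding Q_def W_def
      by (auto intro!: derivative_eq_intros dU dV simp: algebra_simps)
    have "((\<lambda>s. (V s)\<^sup>2 powr e) has_real_derivative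
        e * (V s)\<^sup>2 powr (e - 1) * (2 * V s * ((\<alpha> - 1) * U s))) (at s)"
      using that by (auto intro!: derivative_eq_intros dV)
    moreover have "(V s)\<^sup>2 powr (e - 1) = (V s)\<^sup>2 powr e / (V s)\<^sup>2"
      using that by (simp add: powr_diff)
    ultimately have dP: "((\<lambda>s. (V s)\<^sup>2 powr e) has_real_derivative
        e * ((V s)\<^sup>2 powr e / (V s)\<^sup>2) * (2 * V s * ((\<alpha> - 1) * U s))) (at s)"
      by simp
    have e: "e * (\<alpha> - 1) = - \<alpha>"
      using \<alpha> by (simp add: e_def field_simps)
    have "(Z has_real_derivative - 2 * U s * W s * ((V s)\<^sup>2 powr e) +
       e * ((V s)\<^sup>2 powr e / (V s)\<^sup>2) * (2 * V s * ((\<alpha> - 1) * U s)) * Q s) (at s)"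
      unfolding Z_def using DERIV_mult[OF dQ dP] by (simp add: algebra_simps)
    moreover have "- 2 * U s * W s * ((V s)\<^sup>2 powr e) +
       e * ((V s)\<^sup>2 powr e / (V s)\<^sup>2) * (2 * V s * ((\<alpha> - 1) * U s)) * Q s
       = 2 * U s * ((V s)\<^sup>2 powr e) / V s * (e * (\<alpha> - 1) * Q s - V s * W s)"
      using that by (simp add: field_simps power2_eq_square)
    moreover have "\<dots> = 0"
      by (simp only: e VW) simp
    ultimately show ?thesis by metis
  qed
  \<comment> \<open>The last zero of \<open>V\<close> in \<open>{0..t}\<close>; there is one because
    \<open>V 0 = 0\<close>, and it is attained by continuity.\<close>
  define s where "s = Sup {s \<in> {0..t}. V s = 0}"
  have "closed ({0..t} \<inter> V -` {0})"
    by (rule continuous_closed_preimage) (auto intro: contV)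
  then have cl: "closed {s \<in> {0..t}. V s = 0}"
    by (simp add: vimage_def Int_def)
  have ne: "{s \<in> {0..t}. V s = 0} \<noteq> {}" using V0 t by (auto intro!: exI[of _ 0])
  have bd: "bdd_above {s \<in> {0..t}. V s = 0}" by (rule bdd_aboveI[of _ t]) auto
  have "s \<in> {s \<in> {0..t}. V s = 0}"
    unfolding s_def by (rule closed_contains_Sup[OF ne bd cl])
  then have s: "0 \<le> s" "s < t" "V s = 0" using t(2) by (auto simp: order.order_iff_strict)
  have nz: "V x \<noteq> 0" if "s < x" "x \<le> t" for x
  proof
    assume "V x = 0"
    then have "x \<le> s" unfolding s_def by (intro cSup_upper bd) (use that s in auto)
    with that show False by simp
  qed
  have Zc: "Z x = Z t" if "s < x" "x < t" for x
  proof (rule DERIV_isconst2[of x t Z t, symmetric])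
    show "continuous_on {x..t} Z"
      by (rule DERIV_continuous_on[of _ _ "\<lambda>_. 0"], rule has_field_derivative_at_within, rule dZ)
         (use that nz in auto)
  qed (use that nz dZ in auto)
  \<comment> \<open>This is \<open>1 + 2 * e\<close>: one power of \<open>\<bar>V\<bar>\<close>
    comes from \<open>V * W = - \<alpha> * Q\<close>. Its positivity is where
    \<open>- 1 < \<alpha>\<close> enters.\<close>
  define k where "k = (1 + \<alpha>) / (1 - \<alpha>)"
  have k: "k > 0" using \<alpha> by (simp add: k_def)
  have Zabs: "\<bar>\<alpha> * Z x\<bar> = \<bar>W x\<bar> * \<bar>V x\<bar> powr k" if "V x \<noteq> 0" for x
  proof -
    have "(V x)\<^sup>2 powr e = \<bar>V x\<bar> powr (2 * e)"
      using that powr_powr[of "\<bar>V x\<bar>" 2 e] by simp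
    moreover have "k = 1 + 2 * e" using \<alpha> by (simp add: k_def e_def field_simps)
    ultimately have "\<bar>V x\<bar> powr k = \<bar>V x\<bar> * (V x)\<^sup>2 powr e"
      using that by (simp add: powr_add)
    moreover have "\<bar>\<alpha> * Z x\<bar> = \<bar>V x * W x\<bar> * (V x)\<^sup>2 powr e"
      unfolding VW Z_def by (simp add: abs_mult)
    ultimately show ?thesis by (simp add: abs_mult)
  qed
  have "((\<lambda>x. \<bar>W x\<bar> * \<bar>V x\<bar> powr k) \<longlongrightarrow> \<bar>W s\<bar> * \<bar>V s\<bar> powr k) (at s)"
  proof -
    have "continuous_on UNIV (\<lambda>x. \<bar>W x\<bar> * \<bar>V x\<bar> powr k)"
      unfolding W_def using k
      by (auto intro!: continuous_intros continuous_on_powr' contV contU')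
    then show ?thesis by (simp add: continuous_on_def)
  qed
  then have "((\<lambda>x. \<bar>W x\<bar> * \<bar>V x\<bar> powr k) \<longlongrightarrow> 0) (at_right s)"
    using s k by (auto intro: tendsto_within_subset)
  \<comment> \<open>To the right of \<open>s\<close> the same function is constant, so its limit
    zero forces the constant to vanish.\<close>
  moreover have "eventually (\<lambda>x. \<bar>W x\<bar> * \<bar>V x\<bar> powr k = \<bar>\<alpha> * Z t\<bar>) (at_right s)"
    unfolding eventually_at_right_field
  proof (intro exI[of _ t] conjI allI impI s(2))
    fix x assume "s < x" "x < t"
    then show "\<bar>W x\<bar> * \<bar>V x\<bar> powr k = \<bar>\<alpha> * Z t\<bar>"
      using Zabs[of x] nz[of x] Zc[of x] by simp
  qed
  ultimately have "((\<lambda>x. \<bar>\<alpha> * Z t\<bar>) \<longlongrightarrow> 0) (at_right s)"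
    by (rule Lim_transform_eventually)
  then have "\<alpha> * Z t = 0" by (simp add: tendsto_const_iff)
  with Zabs[OF t(2)] t(2) have "W t = 0" by simp
  then show ?thesis by (simp add: W_def)
qed

text \<open>A point either is approached by points with \<open>V \<noteq> 0\<close>, and continuity
  of \<open>F\<close> applies, or has a neighbourhood on which \<open>V\<close> vanishes. This
  passes from the nonzero set of \<open>V\<close> to all positive angles.\<close>

lemma dense_nonzero_or_locally_zero:
  fixes V F :: "real \<Rightarrow> real"
  assumes F: "continuous_on UNIV F" and t: "0 < t"
    and nz: "\<And>s. 0 < s \<Longrightarrow> V s \<noteq> 0 \<Longrightarrow> F s = 0"
    and lz: "\<And>s. 0 < s \<Longrightarrow> eventually (\<lambda>x. V x = 0) (nhds s) \<Longrightarrow> F s = 0"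
  shows "F t = 0"
proof (rule ccontr)
  assume "F t \<noteq> 0"
  moreover have "isCont F t" using F by (simp add: continuous_on_eq_continuous_at)
  ultimately have "eventually (\<lambda>x. F x \<noteq> 0) (nhds t)"
    by (metis isCont_def tendsto_at_iff_tendsto_nhds t1_space_nhds tendsto_imp_eventually_ne)
  moreover have "eventually (\<lambda>x. x > 0) (nhds t)"
    using t by (intro eventually_nhds_in_open[of "{0<..}", simplified]) auto
  ultimately have "eventually (\<lambda>x. V x = 0) (nhds t)"
    by eventually_elim (use nz in blast)
  with lz t \<open>F t \<noteq> 0\<close> show False by blast
qed

lemma locally_zero_derivative:
  fixes V :: "real \<Rightarrow> real"
  assumes "eventually (\<lambda>x. V x = 0) (nhds s)" and "\<And>t. (V has_real_derivative V' t) (at t)"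
  shows "eventually (\<lambda>x. V' x = 0) (nhds s)"
proof -
  have "eventually (\<lambda>x. eventually (\<lambda>x. V x = 0) (nhds x)) (nhds s)"
    using assms(1) by (simp add: eventually_eventually)
  then show ?thesis
  proof eventually_elim
    case (elim x)
    have "(V has_real_derivative 0) (at x)"
      using elim by (subst DERIV_cong_ev[of x x V "\<lambda>_. 0" 0 0]) auto
    then show ?case using DERIV_unique assms(2) by blast
  qed
qed

text \<open>At \<open>\<alpha> = - 1\<close> the weight exponent
  \<open>(1 + \<alpha>) / (1 - \<alpha>)\<close> degenerates to zero, so conservation only makes
  \<open>W\<close> locally constant where \<open>V \<noteq> 0\<close>. The assumption
  \<open>C2\<close> supplies a continuous \<open>W'\<close>, which joins the pieces, and the value
  of \<open>W\<close> at \<open>0\<close>.\<close>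

lemma polar_vorticity_zero:
  fixes U V U' :: "real \<Rightarrow> real"
  assumes dU: "\<And>t. (U has_real_derivative U' t) (at t)"
    and dV: "\<And>t. (V has_real_derivative (\<alpha> - 1) * U t) (at t)"
    and eq: "\<And>t. V t * U' t = \<alpha> * (U t)\<^sup>2 + (V t)\<^sup>2 + 2 * \<alpha> * c"
    and contU': "continuous_on UNIV U'"
    and V0: "V 0 = 0" and t: "0 < t"
    and \<alpha>: "- 1 \<le> \<alpha>" "\<alpha> \<le> 1"
    and C2: "\<alpha> = - 1 \<Longrightarrow> U' 0 = 0 \<and> (\<exists>W'. continuous_on UNIV W' \<and>
        (\<forall>t. ((\<lambda>t. (1 - \<alpha>) * V t - U' t) has_real_derivative W' t) (at t)))"
  shows "(1 - \<alpha>) * V t - U' t = 0"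
proof -
  define W where "W s = (1 - \<alpha>) * V s - U' s" for s
  have contV: "continuous_on UNIV V"
    using dV by (meson DERIV_isCont continuous_at_imp_continuous_on)
  have contW: "continuous_on UNIV W"
    unfolding W_def by (intro continuous_intros contV contU')
  have lz: "eventually (\<lambda>x. W x = 0) (nhds s)"
    if "eventually (\<lambda>x. V x = 0) (nhds s)" "\<alpha> \<noteq> 1" for s
  proof -
    have "eventually (\<lambda>x. U x = 0) (nhds s)"
      using locally_zero_derivative[OF that(1) dV] that(2) by simp
    then have "eventually (\<lambda>x. U' x = 0) (nhds s)"
      by (rule locally_zero_derivative) (rule dU)
    with that(1) show ?thesis by eventually_elim (simp add: W_def)
  qed
  consider "\<alpha> = 1" | "\<alpha> = - 1" | "- 1 < \<alpha>" "\<alpha> < 1" using \<alpha> by linarith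
  then have "W t = 0"
  proof cases
    case 1
    then have "\<And>t. (V has_real_derivative 0) (at t)" using dV by simp
    then have V: "V s = 0" for s using V0 DERIV_isconst_all[of V] by metis
    then have U2: "(U s)\<^sup>2 = - 2 * c" for s using eq[of s] 1 by simp
    have "U' t = 0"
    \<comment> \<open>As \<open>U\<^sup>2\<close> is constant, a zero at \<open>t\<close> makes
      \<open>U\<close> vanish identically; otherwise differentiating the square gives
      \<open>U' t = 0\<close>.\<close>
    proof (cases "U t = 0")
      case True
      then have "U = (\<lambda>_. 0)" using U2[of t] U2 by auto
      then show ?thesis using dU[of t] DERIV_unique[OF _ DERIV_const] by blast
    next
      case False
      have "((\<lambda>s. (U s)\<^sup>2) has_real_derivative 2 * U t * U' t) (at t)"
        by (auto intro!: derivative_eq_intros dU)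
      then have "2 * U t * U' t = 0"
        unfolding U2 using DERIV_unique[OF _ DERIV_const] by blast
      with False show ?thesis by simp
    qed
    with V show ?thesis by (simp add: W_def)
  next
    case 2
    obtain W' where W': "continuous_on UNIV W'" "\<And>t. (W has_real_derivative W' t) (at t)"
      and U'0: "U' 0 = 0"
      using C2[OF 2] unfolding W_def by blast
    have *: "W' s = 0" if "0 < s" for s
    proof (rule dense_nonzero_or_locally_zero[OF W'(1) that, where V = V])
      fix s assume "V s \<noteq> 0"
      have VW: "V s * W s = (U s)\<^sup>2 + (V s)\<^sup>2 + 2 * c" for s
        using eq[of s] 2 by (simp add: W_def algebra_simps power2_eq_square)
      \<comment> \<open>The product \<open>V * W\<close> is differentiated directly and through the
        Bernoulli expression. Comparing the two leaves \<open>V * W' = 0\<close>.\<close>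
      have "((\<lambda>s. V s * W s) has_real_derivative - 2 * U s * W s + V s * W' s) (at s)"
        using 2 by (auto intro!: derivative_eq_intros dV W'(2))
      moreover have "((\<lambda>s. V s * W s) has_real_derivative 2 * U s * U' s + 2 * V s * (- 2 * U s)) (at s)"
        unfolding VW using dV[of s] 2 by (auto intro!: derivative_eq_intros dU)
      ultimately have "- 2 * U s * W s + V s * W' s = 2 * U s * U' s + 2 * V s * (- 2 * U s)"
        by (rule DERIV_unique)
      then have "V s * W' s = 0" unfolding W_def using 2 by (simp add: algebra_simps)
      with \<open>V s \<noteq> 0\<close> show "W' s = 0" by simp
    next
      fix s assume "eventually (\<lambda>x. V x = 0) (nhds s)"
      from locally_zero_derivative[OF lz[OF this] W'(2)] 2 show "W' s = 0"
        by (auto dest: eventually_nhds_x_imp_x)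
    qed
    have "W t = W 0"
      by (rule DERIV_isconst2[of 0 t W t])
         (use t * W' contW in \<open>auto intro: continuous_on_subset, metis\<close>)
    then show ?thesis using V0 U'0 by (simp add: W_def)
  next
    case 3
    show ?thesis
    proof (rule dense_nonzero_or_locally_zero[OF contW t, where V = V])
      show "W s = 0" if "0 < s" "V s \<noteq> 0" for s
        using vanishing_of_weighted_vorticity[OF dU dV eq contU' 3 V0 that] by (simp add: W_def)
      show "W s = 0" if "eventually (\<lambda>x. V x = 0) (nhds s)" for s
        using lz[OF that] 3 by (auto dest: eventually_nhds_x_imp_x)
    qed
  qed
  then show ?thesis by (simp add: W_def)
qed

section \<open>From the Euler equations to the angular system\<close>

text \<open>On the unit circle the radial derivative of \<open>u\<close> is
  \<open>- \<alpha>\<close> times \<open>u\<close> by homogeneity, and the tangential one is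
  expressed through \<open>U'\<close> and \<open>V'\<close>. Incompressibility and the radial
  momentum balance then become the two angular equations.\<close>

lemma polar_system:
  fixes u :: "real ^ 2 \<Rightarrow> real ^ 2" and p :: "real ^ 2 \<Rightarrow> real"
  assumes C1: "Ck_on 1 punctured_plane u"
    and euler: "classical_euler_on punctured_plane u p"
    and hom: "homogeneous_on \<alpha> punctured_plane u p"
    and p: "\<And>x. x \<noteq> 0 \<Longrightarrow> p x = c * norm x powr (- 2 * \<alpha>)"
  defines "U \<equiv> \<lambda>t. u (circ t) \<bullet> circ t" and "V \<equiv> \<lambda>t. u (circ t) \<bullet> perp (circ t)"
  obtains U' where "\<And>t. (U has_real_derivative U' t) (at t)"
    "\<And>t. (V has_real_derivative (\<alpha> - 1) * U t) (at t)"
    "\<And>t. V t * U' t = \<alpha> * (U t)\<^sup>2 + (V t)\<^sup>2 + 2 * \<alpha> * c"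
    "continuous_on UNIV U'"
    "\<And>t. vorticity u (circ t) = (1 - \<alpha>) * V t - U' t"
proof -
  define D where "D x = frechet_derivative u (at x)" for x
  have D: "(u has_derivative D x) (at x)" if "x \<noteq> 0" for x
    using C1 that unfolding D_def by (auto simp: frechet_derivative_works[symmetric])
  have contD: "continuous_on punctured_plane (\<lambda>x. D x v)" for v
    using C1 unfolding D_def by simp
  define P where "P x h = c * (- 2 * \<alpha>) * (x \<bullet> h)" for x h :: "real ^ 2"
  have P: "(p has_derivative P (circ t)) (at (circ t))" for t
  proof -
    have "(norm has_derivative (\<lambda>h. h \<bullet> circ t)) (at (circ t))"
      using has_derivative_norm[of "circ t"] by (simp add: sgn_div_norm)
    then have "((\<lambda>x. c * norm x powr (- 2 * \<alpha>)) has_derivative P (circ t)) (at (circ t))"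
      unfolding P_def
      by (auto intro!: derivative_eq_intros simp: fun_eq_iff algebra_simps inner_commute)
    then show ?thesis
      by (rule has_derivative_transform_within_open[of _ _ _ _ "- {0}"]) (auto simp: p)
  qed
  have radial: "D (circ t) (circ t) = - \<alpha> *\<^sub>R u (circ t)" for t
  proof (rule homogeneous_derivative[OF D])
    fix l :: real assume "l > 0"
    have "u (circ t) = l powr \<alpha> *\<^sub>R u (l *\<^sub>R circ t)"
      using hom \<open>l > 0\<close> circ_nonzero[of t] unfolding homogeneous_on_def by blast
    then show "u (l *\<^sub>R circ t) = l powr - \<alpha> *\<^sub>R u (circ t)"
      using \<open>l > 0\<close> by (simp add: powr_minus)
  qed simp
  \<comment> \<open>The derivative of \<open>u\<close> along the circle. The terms
    \<open>V t\<close> and \<open>- U t\<close> below come from the rotation of the polar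
    frame.\<close>
  define T where "T t = D (circ t) (perp (circ t))" for t
  define U' where "U' t = T t \<bullet> circ t + V t" for t
  define V' where "V' t = T t \<bullet> perp (circ t) - U t" for t
  have du: "((\<lambda>t. u (circ t)) has_vector_derivative T t) (at t)" for t
    using vector_derivative_diff_chain_within[of circ "perp (circ t)" t UNIV u "D (circ t)"]
      has_derivative_at_withinI[OF D[of "circ t"]] has_vector_derivative_circ[of t UNIV]
    by (simp add: o_def T_def)
  have dU: "(U has_real_derivative U' t) (at t)" for t
    using bounded_bilinear.has_vector_derivative[OF bounded_bilinear_inner du[of t] has_vector_derivative_circ]
    by (simp add: U_def V_def U'_def has_real_derivative_iff_has_vector_derivative add.commute)
  have dV: "(V has_real_derivative V' t) (at t)" for t
    using bounded_bilinear.has_vector_derivative[OF bounded_bilinear_inner du[of t] has_vector_derivative_perp_circ]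
    by (simp add: U_def V_def V'_def has_real_derivative_iff_has_vector_derivative)
  have E: "\<And>j. D (circ t) (u (circ t)) $ j + P (circ t) (axis j 1) = 0"
    "D (circ t) (axis 1 1) $ 1 + D (circ t) (axis 2 1) $ 2 = 0" for t
  proof -
    have "classical_euler_on {circ t} u p"
      using euler unfolding classical_euler_on_def by simp
    then show "\<And>j. D (circ t) (u (circ t)) $ j + P (circ t) (axis j 1) = 0"
      "D (circ t) (axis 1 1) $ 1 + D (circ t) (axis 2 1) $ 2 = 0"
      using classical_euler_on_iff[of "{circ t}" u D p P] D P by auto
  qed
  have lin: "D (circ t) v = v $ 1 *\<^sub>R D (circ t) (axis 1 1) + v $ 2 *\<^sub>R D (circ t) (axis 2 1)" for t v
    by (rule linear_real2[OF has_derivative_linear[OF D[OF circ_nonzero]]])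
  have cs: "cos t * (cos t * a) + sin t * (sin t * a) = a"
    "cos t * (cos t * a) + (sin t * (sin t * a) + b) = a + b" for a b t :: real
    using sin_cos_squared_add[of t] by algebra+
  have u_dec: "u (circ t) = U t *\<^sub>R circ t + V t *\<^sub>R perp (circ t)" for t
  proof -
    show ?thesis
      unfolding vec_eq_real2 U_def V_def inner_real2 by (simp add: algebra_simps cs)
  qed
  have div: "V' t = (\<alpha> - 1) * U t" for t
  proof -
    \<comment> \<open>The trace of \<open>D (circ t)\<close> is the same in the polar frame as in
      the Cartesian one.\<close>
    have "D (circ t) (circ t) \<bullet> circ t + T t \<bullet> perp (circ t) =
        (D (circ t) (axis 1 1) $ 1 + D (circ t) (axis 2 1) $ 2) * ((cos t)\<^sup>2 + (sin t)\<^sup>2)"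
      unfolding T_def lin[of t "circ t"] lin[of t "perp (circ t)"] inner_real2
      by (simp add: algebra_simps cs)
    then have "D (circ t) (circ t) \<bullet> circ t + T t \<bullet> perp (circ t) = 0"
      using E(2) by simp
    then show ?thesis unfolding radial V'_def U_def by (simp add: algebra_simps)
  qed
  have vort: "vorticity u (circ t) = (1 - \<alpha>) * V t - U' t" for t
  proof -
    \<comment> \<open>The antisymmetric part, too, is unchanged by rotating the frame.\<close>
    have "D (circ t) (circ t) \<bullet> perp (circ t) - T t \<bullet> circ t =
        (D (circ t) (axis 1 1) $ 2 - D (circ t) (axis 2 1) $ 1) * ((cos t)\<^sup>2 + (sin t)\<^sup>2)"
      unfolding T_def lin[of t "circ t"] lin[of t "perp (circ t)"] inner_real2
      by (simp add: algebra_simps cs)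
    then have "D (circ t) (circ t) \<bullet> perp (circ t) - T t \<bullet> circ t = vorticity u (circ t)"
      unfolding vorticity_eq[OF D[OF circ_nonzero]] by simp
    then show ?thesis unfolding radial U'_def V_def by (simp add: algebra_simps)
  qed
  have mom: "V t * U' t = \<alpha> * (U t)\<^sup>2 + (V t)\<^sup>2 + 2 * \<alpha> * c" for t
  proof -
    have "D (circ t) (u (circ t)) $ j = - P (circ t) (axis j 1)" for j
      using E(1)[of t j] by (simp add: eq_neg_iff_add_eq_0)
    then have "D (circ t) (u (circ t)) \<bullet> circ t = - P (circ t) (axis 1 1) * cos t - P (circ t) (axis 2 1) * sin t"
      by (simp add: inner_real2)
    also have "\<dots> = 2 * \<alpha> * c"
      unfolding P_def inner_real2 circ_nth axis_real2
      using sin_cos_squared_add[of t] by algebra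
    finally have 1: "D (circ t) (u (circ t)) \<bullet> circ t = 2 * \<alpha> * c" .
    have l: "linear (D (circ t))" by (rule has_derivative_linear[OF D[OF circ_nonzero]])
    have "D (circ t) (u (circ t)) = U t *\<^sub>R D (circ t) (circ t) + V t *\<^sub>R T t"
      unfolding T_def by (subst u_dec) (simp add: linear_add[OF l] linear_scale[OF l])
    then have "D (circ t) (u (circ t)) \<bullet> circ t = - \<alpha> * U t * U t + V t * (U' t - V t)"
      unfolding radial U'_def by (simp add: inner_add_left inner_diff_left U_def)
    with 1 show ?thesis by (simp add: algebra_simps power2_eq_square)
  qed
  have "continuous_on UNIV (\<lambda>t. D (circ t) v)" for v
    by (rule continuous_on_compose2[OF contD continuous_on_circ]) auto
  then have "continuous_on UNIV T"
    unfolding T_def lin[of _ "perp _"] by (auto intro!: continuous_intros)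
  moreover have "continuous_on UNIV (\<lambda>t. u (circ t))"
    using du by (meson continuous_at_imp_continuous_on has_vector_derivative_continuous)
  ultimately have contU': "continuous_on UNIV U'"
    unfolding U'_def V_def perp_circ
    by (intro continuous_intros continuous_on_compose2[OF continuous_on_circ]) auto
  show ?thesis
    by (rule that[of U']) (use dU dV div mom contU' vort in auto)
qed

text \<open>Vorticity is linear in the first derivatives of a field of degree
  \<open>- \<alpha>\<close>. Hence its vanishing on the unit circle spreads to the punctured
  plane.\<close>

lemma vorticity_scale:
  assumes "Ck_on 1 punctured_plane u" "homogeneous_on \<alpha> punctured_plane u p" "x \<noteq> 0" "l > 0"
  shows "vorticity u (l *\<^sub>R x) = l powr (- \<alpha> - 1) * vorticity u x"
proof -
  define D where "D x = frechet_derivative u (at x)" for x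
  have D: "(u has_derivative D x) (at x)" if "x \<noteq> 0" for x
    using assms(1) that unfolding D_def by (auto simp: frechet_derivative_works[symmetric])
  have "u (l *\<^sub>R y) = l powr - \<alpha> *\<^sub>R u y" if "y \<noteq> 0" for y
  proof -
    have "u y = l powr \<alpha> *\<^sub>R u (l *\<^sub>R y)"
      using assms(2,4) that unfolding homogeneous_on_def by blast
    then show ?thesis using assms(4) by (simp add: powr_minus)
  qed
  then have "D (l *\<^sub>R x) v = l powr (- \<alpha> - 1) *\<^sub>R D x v" for v
    using assms(3,4)
    by (intro homogeneous_derivative_scale[of u "D x" x _ l "- {0}"] D) auto
  then show ?thesis
    using assms(3,4) by (simp add: vorticity_eq[OF D] right_diff_distrib)
qed

text \<open>Serves both nonexistence claims. The \<open>C^2\<close> assumption is called upon at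
  \<open>\<alpha> = - 1\<close>, where it makes the vorticity on the circle continuously
  differentiable.\<close>

lemma admissible_imp_not_small_exponent:
  assumes C1: "Ck_on 1 punctured_plane u"
    and euler: "classical_euler_on punctured_plane u p"
    and adm: "admissible_on \<alpha> punctured_plane u p"
    and \<alpha>: "- 1 \<le> \<alpha>" "\<alpha> \<le> 1"
    and C2: "\<alpha> = - 1 \<Longrightarrow> Ck_on 2 punctured_plane u"
  shows False
proof -
  have hom: "homogeneous_on \<alpha> punctured_plane u p"
    and symm: "reflection_symmetric_on punctured_plane u p"
    and rot: "rotational u"
    using adm unfolding admissible_on_def by auto
  obtain c where c: "\<And>x. x \<noteq> 0 \<Longrightarrow> norm x powr (2 * \<alpha>) * p x = c"
    using adm unfolding admissible_on_def scaled_pressure_const_def by auto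
  have p: "p x = c * norm x powr (- 2 * \<alpha>)" if "x \<noteq> 0" for x
    using c[OF that] that by (simp add: powr_minus field_simps)
  define U where "U t = u (circ t) \<bullet> circ t" for t
  define V where "V t = u (circ t) \<bullet> perp (circ t)" for t
  obtain U' where sys: "\<And>t. (U has_real_derivative U' t) (at t)"
    "\<And>t. (V has_real_derivative (\<alpha> - 1) * U t) (at t)"
    "\<And>t. V t * U' t = \<alpha> * (U t)\<^sup>2 + (V t)\<^sup>2 + 2 * \<alpha> * c"
    "continuous_on UNIV U'"
    and vort: "\<And>t. vorticity u (circ t) = (1 - \<alpha>) * V t - U' t"
    using polar_system[OF C1 euler hom p] unfolding U_def V_def by blast
  have sym: "u (circ (- t)) $ 1 = u (circ t) $ 1" "u (circ (- t)) $ 2 = - u (circ t) $ 2" for t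
  proof -
    have "reflect (circ t) = circ (- t)" by (simp add: vec_eq_real2)
    moreover have "circ t \<in> punctured_plane" by simp
    ultimately have "u (circ t) $ 1 = u (circ (- t)) $ 1 \<and> u (circ t) $ 2 = - u (circ (- t)) $ 2"
      using symm unfolding reflection_symmetric_on_def by metis
    then show "u (circ (- t)) $ 1 = u (circ t) $ 1" "u (circ (- t)) $ 2 = - u (circ t) $ 2"
      by auto
  qed
  \<comment> \<open>The reflection fixes \<open>circ 0\<close> and reverses the angular direction
    there. It also makes \<open>U\<close> even, whence \<open>U' 0 = 0\<close>.\<close>
  have V0: "V 0 = 0" using sym(2)[of 0] by (simp add: V_def inner_real2)
  have "U (- t) = U t" for t by (simp add: U_def inner_real2 sym)
  then have "(U has_real_derivative - U' 0) (at 0)"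
    using DERIV_mirror[of U "U' 0" 0] sys(1)[of 0] by simp
  from DERIV_unique[OF sys(1)[of 0] this] have U'0: "U' 0 = 0" by simp
  have W: "\<exists>W'. continuous_on UNIV W' \<and>
      (\<forall>t. ((\<lambda>t. (1 - \<alpha>) * V t - U' t) has_real_derivative W' t) (at t))" if "\<alpha> = - 1"
  proof -
    define D where "D v x = frechet_derivative u (at x) v" for v x
    have C2': "Ck_on 1 punctured_plane (D v)" for v
      using C2[OF that] unfolding D_def numeral_2_eq_2 One_nat_def by (subst (asm) Ck_on.simps) simp
    define D2 where "D2 v x = frechet_derivative (D v) (at x)" for v x
    have D2: "(D v has_derivative D2 v x) (at x)" if "x \<noteq> 0" for v x
      using C2'[of v] that unfolding D2_def by (auto simp: frechet_derivative_works[symmetric])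
    have contD2: "continuous_on punctured_plane (\<lambda>x. D2 v x w)" for v w
      using C2'[of v] unfolding D2_def by simp
    define T where "T v t = D2 v (circ t) (perp (circ t))" for v t
    have dD: "((\<lambda>t. D v (circ t)) has_vector_derivative T v t) (at t)" for v t
      using vector_derivative_diff_chain_within[of circ "perp (circ t)" t UNIV "D v" "D2 v (circ t)"]
        has_derivative_at_withinI[OF D2[of "circ t"]] has_vector_derivative_circ[of t UNIV]
      by (simp add: o_def T_def)
    have dD': "((\<lambda>t. D v (circ t) $ i) has_real_derivative T v t $ i) (at t)" for v t i
      using bounded_linear.has_vector_derivative[OF bounded_linear_vec_nth dD]
      by (simp add: has_real_derivative_iff_has_vector_derivative)
    have D2_lin: "D2 v (circ t) w = w $ 1 *\<^sub>R D2 v (circ t) (axis 1 1) + w $ 2 *\<^sub>R D2 v (circ t) (axis 2 1)" for t v w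
      by (rule linear_real2[OF has_derivative_linear[OF D2[OF circ_nonzero]]])
    have "continuous_on UNIV (\<lambda>t. D2 v (circ t) w)" for v w
      by (rule continuous_on_compose2[OF contD2 continuous_on_circ]) auto
    then have contT: "continuous_on UNIV (T v)" for v
      unfolding T_def D2_lin[of _ _ "perp _"] by (auto intro!: continuous_intros)
    \<comment> \<open>The vorticity is a combination of first derivatives of \<open>u\<close>, so
      its derivative along the circle is a combination of continuous second derivatives.\<close>
    have "vorticity u (circ t) = D (axis 1 1) (circ t) $ 2 - D (axis 2 1) (circ t) $ 1" for t
      unfolding D_def using C1 by (intro vorticity_eq) (auto simp: frechet_derivative_works[symmetric])
    then have "((\<lambda>t. (1 - \<alpha>) * V t - U' t) has_real_derivative T (axis 1 1) t $ 2 - T (axis 2 1) t $ 1) (at t)" for t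
      unfolding vort[symmetric] by (auto intro!: derivative_eq_intros dD')
    moreover have "continuous_on UNIV (\<lambda>t. T (axis 1 1) t $ 2 - T (axis 2 1) t $ 1)"
      by (intro continuous_intros contT)
    ultimately show ?thesis by blast
  qed
  have zero: "vorticity u (circ t) = 0" if "t > 0" for t
    unfolding vort
    by (rule polar_vorticity_zero[OF sys V0 that \<alpha>]) (use W U'0 in auto)
  have "vorticity u x = 0" if "x \<noteq> 0" for x
  proof -
    obtain r t where x: "x = r *\<^sub>R circ t" "r = norm x" "0 < t" "t \<le> 2 * pi"
      by (rule polar_decomposition)
    then have "vorticity u (r *\<^sub>R circ t) = r powr (- \<alpha> - 1) * vorticity u (circ t)"
      using that by (intro vorticity_scale[OF C1 hom]) auto
    with zero[OF x(3)] x(1) show ?thesis by simp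
  qed
  with rot show False unfolding irrotational_def by simp
qed

subsection \<open>A hardening oscillator with integer frequency\<close>

text \<open>The value \<open>q\<close> at \<open>1\<close> is the derivative of
  \<open>t powr q\<close> there. With \<open>t = (sin x)\<^sup>2\<close> and
  \<open>q = m / 2\<close> this quotient removes the common zero of
  \<open>1 - \<bar>sin x\<bar> powr m\<close> and \<open>(cos x)\<^sup>2\<close>.\<close>

lemma continuous_on_powr_difference_quotient:
  fixes q :: real
  assumes "q > 0"
  shows "continuous_on {0..1} (\<lambda>t. if t = 1 then q else (1 - t powr q) / (1 - t))"
proof -
  let ?h = "\<lambda>t::real. if t = 1 then q else (1 - t powr q) / (1 - t)"
  have "((\<lambda>t. t powr q) has_real_derivative q) (at (1::real))"
    by (auto intro!: derivative_eq_intros)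
  then have lim: "((\<lambda>t. (t powr q - 1) / (t - 1)) \<longlongrightarrow> q) (at (1::real))"
    by (simp add: has_field_derivative_iff)
  have eq: "(t powr q - 1) / (t - 1) = ?h t" if "t \<noteq> 1" for t :: real
    using that minus_divide_divide[of "1 - t powr q" "1 - t"] by simp
  have "\<forall>\<^sub>F t in at 1. (t powr q - 1) / (t - 1) = ?h t"
    unfolding eventually_at_filter by (intro always_eventually allI impI eq)
  with lim have "(?h \<longlongrightarrow> q) (at 1)" by (rule Lim_transform_eventually)
  then have 1: "(?h \<longlongrightarrow> ?h 1) (at 1 within {0..1})"
    by (auto intro: tendsto_within_subset)
  have 2: "continuous_on ({0..1} - {1}) ?h"
  proof -
    have "continuous_on ({0..1} - {1}) (\<lambda>t. (1 - t powr q) / (1 - t))"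
      using assms by (auto intro!: continuous_intros continuous_on_powr')
    then show ?thesis by (rule continuous_on_eq) auto
  qed
  show ?thesis
    unfolding continuous_on_eq_continuous_within
  proof
    fix x :: real assume x: "x \<in> {0..1}"
    show "continuous (at x within {0..1}) ?h"
    proof (cases "x = 1")
      case True
      with 1 show ?thesis by (simp add: continuous_within)
    next
      case False
      have "continuous (at x within {0..1} - {1}) ?h"
        using 2 False x by (simp add: continuous_on_eq_continuous_within)
      moreover have "at x within {0..1} - {1} = at x within {0..1}"
        by (rule at_within_nhd[of _ "- {1}"]) (use False in auto)
      ultimately show ?thesis by simp
    qed
  qed
qed

text \<open>The integral is the time in which a phase obeying
  \<open>\<theta>' = sqrt (\<nu>\<^sup>2 + D * H \<theta>)\<close> makes one turn. It depends
  continuously on \<open>D\<close> and exceeds \<open>2 * pi / n\<close> at \<open>D = 0\<close>, so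
  the intermediate value theorem gives a positive \<open>D\<close>.\<close>

lemma exists_stiffness:
  fixes H :: "real \<Rightarrow> real"
  assumes H: "continuous_on UNIV H" and pos: "\<And>x. H x > 0"
    and \<nu>: "0 < \<nu>" "\<nu> < n"
  obtains D where "D > 0" "integral {0..2 * pi} (\<lambda>x. 1 / sqrt (\<nu>\<^sup>2 + D * H x)) = 2 * pi / n"
proof -
  let ?f = "\<lambda>D x. 1 / sqrt (\<nu>\<^sup>2 + D * H x)"
  define I where "I D = integral {0..2 * pi} (?f D)" for D
  have rad: "\<nu>\<^sup>2 + D * H x > 0" if "D \<ge> 0" for D x
    using \<nu> pos[of x] that by (simp add: add_pos_nonneg)
  have H': "continuous_on S H" for S using H continuous_on_subset by blast
  obtain x0 where x0: "\<And>x. x \<in> {0..2 * pi} \<Longrightarrow> H x0 \<le> H x"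
    using continuous_attains_inf[of "{0..2 * pi}" H] H' by (metis (no_types, lifting) atLeastAtMost_iff compact_Icc emptyE less_imp_le order_refl pi_gt_zero zero_le_mult_iff zero_le_numeral)
  \<comment> \<open>With the minimum \<open>H x0\<close> this makes the radicand at least
    \<open>n\<^sup>2\<close>, so one turn takes at most \<open>2 * pi / n\<close>.\<close>
  define B where "B = n\<^sup>2 / H x0"
  have B: "B > 0" using \<nu> pos by (simp add: B_def)
  have int: "?f D integrable_on {0..2 * pi}" if "D \<ge> 0" for D
    by (intro integrable_continuous_real continuous_intros H')
       (use rad[OF that] in \<open>auto simp: less_imp_neq[symmetric]\<close>)
  have "continuous_on {0..B} (\<lambda>D. integral (cbox 0 (2 * pi)) (?f D))"
    by (rule integral_continuous_on_param)
       (use rad in \<open>auto simp: case_prod_unfold less_imp_neq[symmetric] intro!: continuous_intros continuous_on_compose2[OF H]\<close>)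
  then have cont: "continuous_on {0..B} I" by (simp add: I_def)
  have "I B \<le> 2 * pi / n"
  proof -
    have "I B \<le> integral {0..2 * pi} (\<lambda>x. 1 / n)"
      unfolding I_def
    proof (rule integral_le)
      show "?f B integrable_on {0..2 * pi}" using int B by simp
      fix x assume "x \<in> {0..2 * pi}"
      have "n\<^sup>2 \<le> B * H x"
        using x0[OF \<open>x \<in> _\<close>] pos[of x0] by (simp add: B_def field_simps mult_right_mono)
      also have "\<dots> \<le> \<nu>\<^sup>2 + B * H x" by simp
      finally have "n \<le> sqrt (\<nu>\<^sup>2 + B * H x)"
        by (rule real_le_rsqrt)
      then show "?f B x \<le> 1 / n" using \<nu> rad[of B x] B by (intro divide_left_mono) auto
    qed (intro integrable_continuous_real continuous_intros)
    then show ?thesis by simp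
  qed
  moreover have I0: "I 0 = 2 * pi / \<nu>" using \<nu> by (simp add: I_def)
  then have lt: "2 * pi / n < I 0" using \<nu> by (simp add: divide_strict_left_mono)
  ultimately obtain D where D: "0 \<le> D" "D \<le> B" "I D = 2 * pi / n"
    using IVT2'[of I B "2 * pi / n" 0] cont B by auto
  moreover have "D \<noteq> 0" using D(3) lt by auto
  ultimately show ?thesis using that[of D] by (simp add: I_def)
qed

text \<open>Separation of variables: \<open>\<theta>\<close> is the inverse of an antiderivative
  \<open>F\<close> of \<open>1 / G\<close>. Symmetry of \<open>G\<close> makes \<open>F\<close> odd,
  and the integral condition makes \<open>F\<close> gain \<open>2 * pi / n\<close> per turn, so
  \<open>\<theta>\<close> makes \<open>n\<close> turns in time \<open>2 * pi\<close>.\<close>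

lemma exists_phase:
  fixes G :: "real \<Rightarrow> real" and n :: nat
  assumes G: "continuous_on UNIV G" and pos: "\<And>x. G x > 0"
    and even: "\<And>x. G (- x) = G x" and per: "\<And>x. G (x + 2 * pi) = G x"
    and n: "n > 0" and int: "integral {0..2 * pi} (\<lambda>x. 1 / G x) = 2 * pi / n"
  obtains \<theta> where "\<And>t. (\<theta> has_real_derivative G (\<theta> t)) (at t)" "\<And>t. \<theta> (- t) = - \<theta> t"
    "\<And>t. \<theta> (t + 2 * pi) = \<theta> t + 2 * pi * n" "surj \<theta>"
proof -
  have contG: "isCont G x" for x using G by (simp add: continuous_on_eq_continuous_at)
  have "\<exists>F. \<forall>x::real. - \<infinity> < ereal x \<longrightarrow> ereal x < \<infinity> \<longrightarrow> (F has_vector_derivative 1 / G x) (at x)"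
    by (rule einterval_antiderivative) (use pos in \<open>auto intro!: continuous_intros contG simp: less_imp_neq[symmetric]\<close>)
  then obtain F0 where F0: "\<And>x. (F0 has_real_derivative 1 / G x) (at x)"
    by (auto simp: has_real_derivative_iff_has_vector_derivative)
  \<comment> \<open>Normalised to vanish at \<open>0\<close>, so that the even derivative yields an
    odd function.\<close>
  define F where "F x = F0 x - F0 0" for x
  have F: "(F has_real_derivative 1 / G x) (at x)" for x
    unfolding F_def by (auto intro!: derivative_eq_intros F0)
  have F_0: "F 0 = 0" by (simp add: F_def)
  have mono: "strict_mono F"
    by (rule strict_monoI, rule DERIV_pos_imp_increasing) (use F pos in \<open>auto intro!: exI\<close>)
  have F_odd: "F (- x) = - F x" for x
  proof -
    have "((\<lambda>x. F (- x) + F x) has_real_derivative 0) (at x)" for x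
      by (rule derivative_eq_intros DERIV_chain'[of uminus _ _ _ F] F | simp add: even)+
    with DERIV_isconst_all[of "\<lambda>x. F (- x) + F x"] have "F (- x) + F x = F (- 0) + F 0" by (metis)
    then show ?thesis by (simp add: F_0)
  qed
  have F_per: "F (x + 2 * pi) = F x + 2 * pi / n" for x
  proof -
    have "((\<lambda>x. F (x + 2 * pi) - F x) has_real_derivative 0) (at x)" for x
      by (rule derivative_eq_intros DERIV_chain'[of "\<lambda>x. x + 2 * pi" _ _ _ F] F | simp add: per)+
    with DERIV_isconst_all[of "\<lambda>x. F (x + 2 * pi) - F x"] have "F (x + 2 * pi) - F x = F (0 + 2 * pi) - F 0" by metis
    moreover have "((\<lambda>x. 1 / G x) has_integral (F (2 * pi) - F 0)) {0..2 * pi}"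
      by (rule fundamental_theorem_of_calculus)
         (use F in \<open>auto simp: has_real_derivative_iff_has_vector_derivative intro: has_vector_derivative_at_within\<close>)
    ultimately show ?thesis using int by (simp add: integral_unique)
  qed
  have F_mult: "F (x + 2 * pi * real k) = F x + 2 * pi / n * k" for x k
  proof (induction k)
    case (Suc k)
    then show ?case
      using F_per[of "x + 2 * pi * real k"] by (simp add: algebra_simps add_divide_distrib)
  qed simp
  have contF: "isCont F x" for x using F DERIV_isCont by blast
  have F_surj: "\<exists>x. F x = y" if "y \<ge> 0" for y
  proof -
    obtain k :: nat where k: "y \<le> 2 * pi / n * k"
      using reals_Archimedean3[of "2 * pi / n"] n by (metis divide_pos_pos less_imp_le mult.commute of_nat_0_less_iff pi_gt_zero zero_less_mult_iff zero_less_numeral)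
    then have "y \<le> F (2 * pi * real k)" using F_mult[of 0 k] by (simp add: F_0)
    then show ?thesis
      using IVT[of F 0 y "2 * pi * real k"] that F_0 contF by auto
  qed
  have surj: "surj F"
  proof -
    have "\<exists>x. F x = y" for y
    proof (cases "y \<ge> 0")
      case False
      then obtain x where "F x = - y" using F_surj[of "- y"] by auto
      then have "F (- x) = y" by (simp add: F_odd)
      then show ?thesis ..
    qed (rule F_surj)
    then show ?thesis by (metis surjI)
  qed
  define \<theta> where "\<theta> = inv F"
  have inj: "inj F" using mono strict_mono_imp_inj_on by blast
  have F\<theta>: "F (\<theta> t) = t" for t unfolding \<theta>_def by (rule surj_f_inv_f[OF surj])
  have \<theta>F: "\<theta> (F x) = x" for x unfolding \<theta>_def by (rule inv_f_f[OF inj])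
  have cont\<theta>: "isCont \<theta> t" for t
    using isCont_inverse_function[of 1 "\<theta> t" \<theta> F] \<theta>F contF F\<theta> by auto
  have "(\<theta> has_real_derivative G (\<theta> t)) (at t)" for t
    using DERIV_inverse_function[of F "1 / G (\<theta> t)" \<theta> t "t - 1" "t + 1"] F[of "\<theta> t"] pos[of "\<theta> t"] F\<theta> cont\<theta>
    by auto
  moreover have "\<theta> (- t) = - \<theta> t" for t
    by (metis F_odd F\<theta> \<theta>F)
  moreover have "\<theta> (t + 2 * pi) = \<theta> t + 2 * pi * n" for t
  proof -
    have "F (\<theta> t + 2 * pi * n) = t + 2 * pi" using F_mult[of "\<theta> t" n] n by (simp add: F\<theta>)
    then show ?thesis by (metis \<theta>F)
  qed
  moreover have "surj \<theta>" using \<theta>F by (metis surjI)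
  ultimately show ?thesis by (rule that)
qed

section \<open>Calculus of signed powers and of removable points\<close>

lemma continuous_on_sgn_mult_powr:
  fixes k :: real
  assumes "k > 0"
  shows "continuous_on S (\<lambda>x. sgn x * \<bar>x\<bar> powr k)"
proof -
  \<comment> \<open>Splitting into positive and negative parts avoids the jump of \<open>sgn\<close>
    at zero.\<close>
  have "continuous_on S (\<lambda>x. max x 0 powr k - max (- x) 0 powr k)"
    using assms by (auto intro!: continuous_intros continuous_on_powr')
  moreover have "max x 0 powr k - max (- x) 0 powr k = sgn x * \<bar>x\<bar> powr k" for x
    by (cases x "0::real" rule: linorder_cases) auto
  ultimately show ?thesis by simp
qed

lemma has_derivative_abs_powr:
  fixes x m :: real
  assumes "m > 1"
  shows "((\<lambda>x. \<bar>x\<bar> powr m) has_real_derivative m * (sgn x * \<bar>x\<bar> powr (m - 1))) (at x)"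
proof -
  consider "x > 0" | "x < 0" | "x = 0" by linarith
  then show ?thesis
  proof cases
    case 1
    have "((\<lambda>x. x powr m) has_real_derivative m * (sgn x * \<bar>x\<bar> powr (m - 1))) (at x)"
      using 1 by (auto intro!: derivative_eq_intros simp: powr_diff)
    then show ?thesis
      by (rule has_field_derivative_transform_within_open[of _ _ _ "{0<..}"]) (use 1 in auto)
  next
    case 2
    have "((\<lambda>x. (- x) powr m) has_real_derivative m * (sgn x * \<bar>x\<bar> powr (m - 1))) (at x)"
      using 2 by (auto intro!: derivative_eq_intros simp: powr_diff)
    then show ?thesis
      by (rule has_field_derivative_transform_within_open[of _ _ _ "{..<0}"]) (use 2 in auto)
  next
    case 3
    have "continuous_on UNIV (\<lambda>h::real. \<bar>h\<bar> powr (m - 1))"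
      using assms by (auto intro!: continuous_intros continuous_on_powr')
    then have "((\<lambda>h::real. \<bar>h\<bar> powr (m - 1)) \<longlongrightarrow> 0) (at 0)"
      unfolding continuous_on_def by (auto dest!: spec[of _ 0])
    moreover have "\<bar>\<bar>h\<bar> powr m / h\<bar> = \<bar>h\<bar> powr (m - 1)" for h :: real
      by (cases "h = 0") (auto simp: powr_diff abs_mult)
    ultimately have "((\<lambda>h::real. \<bar>h\<bar> powr m / h) \<longlongrightarrow> 0) (at 0)"
      by (subst tendsto_rabs_zero_iff[symmetric]) simp
    then show ?thesis using 3 assms by (simp add: has_field_derivative_iff)
  qed
qed

lemma has_derivative_sgn_mult_powr:
  fixes x k :: real
  assumes "k > 1"
  shows "((\<lambda>x. sgn x * \<bar>x\<bar> powr k) has_real_derivative k * \<bar>x\<bar> powr (k - 1)) (at x)"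
proof -
  consider "x > 0" | "x < 0" | "x = 0" by linarith
  then show ?thesis
  proof cases
    case 1
    have "((\<lambda>x. x powr k) has_real_derivative k * \<bar>x\<bar> powr (k - 1)) (at x)"
      using 1 by (auto intro!: derivative_eq_intros simp: powr_diff)
    then show ?thesis
      by (rule has_field_derivative_transform_within_open[of _ _ _ "{0<..}"]) (use 1 in auto)
  next
    case 2
    have "((\<lambda>x. - ((- x) powr k)) has_real_derivative k * \<bar>x\<bar> powr (k - 1)) (at x)"
      using 2 by (auto intro!: derivative_eq_intros simp: powr_diff)
    then show ?thesis
      by (rule has_field_derivative_transform_within_open[of _ _ _ "{..<0}"]) (use 2 in auto)
  next
    case 3
    have "continuous_on UNIV (\<lambda>h::real. \<bar>h\<bar> powr (k - 1))"
      using assms by (auto intro!: continuous_intros continuous_on_powr')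
    then have "((\<lambda>h::real. \<bar>h\<bar> powr (k - 1)) \<longlongrightarrow> 0) (at 0)"
      unfolding continuous_on_def by (auto dest!: spec[of _ 0])
    moreover have "sgn h * \<bar>h\<bar> powr k / h = \<bar>h\<bar> powr (k - 1)" for h :: real
      by (cases h "0::real" rule: linorder_cases) (auto simp: powr_diff)
    ultimately have "((\<lambda>h::real. sgn h * \<bar>h\<bar> powr k / h) \<longlongrightarrow> 0) (at 0)" by simp
    then show ?thesis using 3 assms by (simp add: has_field_derivative_iff)
  qed
qed

text \<open>By l'Hopital's rule, a derivative formula valid near \<open>x\<close> extends to
  \<open>x\<close> if its right-hand side is continuous there. It serves at the turning points of
  the oscillator, where the energy equation cannot be differentiated through a square root.\<close>

lemma has_derivative_at_removable_point:
  fixes f f' :: "real \<Rightarrow> real"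
  assumes "isCont f x" "eventually (\<lambda>y. (f has_real_derivative f' y) (at y)) (at x)" "isCont f' x"
  shows "(f has_real_derivative f' x) (at x)"
proof -
  have "((\<lambda>y. (f y - f x) / (y - x)) \<longlongrightarrow> f' x) (at x)"
  proof (rule lhopital[where f' = f' and g' = "\<lambda>_. 1"])
    show "((\<lambda>y. f y - f x) \<longlongrightarrow> 0) (at x)" "((\<lambda>y. y - x) \<longlongrightarrow> 0) (at x)"
      using assms(1) by (auto simp: isCont_def LIM_zero)
    show "\<forall>\<^sub>F y in at x. ((\<lambda>y. f y - f x) has_real_derivative f' y) (at y)"
      using assms(2) by eventually_elim (auto intro!: derivative_eq_intros)
    show "((\<lambda>y. f' y / 1) \<longlongrightarrow> f' x) (at x)" using assms(3) by (simp add: isCont_def)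
    show "\<forall>\<^sub>F y in at x. y - x \<noteq> 0" by (auto simp: eventually_at_filter)
  qed (auto intro!: derivative_eq_intros always_eventually)
  then show ?thesis by (simp add: has_field_derivative_iff)
qed

text \<open>Writing the solution with amplitude 1 as \<open>sin \<theta>\<close>, energy conservation becomes the regular
  equation \<open>\<theta>' = G \<theta>\<close>; the hardening nonlinearity lets the frequency be raised from \<open>\<nu>\<close> to an
  integer.\<close>

lemma exists_periodic_oscillation:
  fixes \<nu> m :: real
  assumes \<nu>: "0 < \<nu>" and m: "1 < m"
  obtains D V V' where "D > 0"
    "\<And>t. (V has_real_derivative V' t) (at t)"
    "\<And>t. (V' has_real_derivative - \<nu>\<^sup>2 * V t - D * m / 2 * (sgn (V t) * \<bar>V t\<bar> powr (m - 1))) (at t)"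
    "\<And>t. (V' t)\<^sup>2 = \<nu>\<^sup>2 * (1 - (V t)\<^sup>2) + D * (1 - \<bar>V t\<bar> powr m)"
    "\<And>t. V (- t) = - V t" "\<And>t. V (t + 2 * pi) = V t" "\<exists>t. V t = 1"
proof -
  \<comment> \<open>Chosen so that
    \<open>1 - \<bar>v\<bar> powr m = (1 - v\<^sup>2) * h (v\<^sup>2)\<close> for
    \<open>\<bar>v\<bar> \<le> 1\<close>. With \<open>v = sin \<theta>\<close> both energy terms
    then carry the factor \<open>(cos \<theta>)\<^sup>2\<close>, and
    \<open>\<theta>' = G \<theta>\<close> has a positive right-hand side.\<close>
  define h where "h t = (if t = 1 then m / 2 else (1 - t powr (m / 2)) / (1 - t))" for t :: real
  define H where "H x = h ((sin x)\<^sup>2)" for x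
  have s1: "(sin x)\<^sup>2 \<le> 1" for x :: real by (simp add: sin_squared_eq)
  have contH: "continuous_on UNIV H"
    unfolding H_def h_def
    by (rule continuous_on_compose2[OF continuous_on_powr_difference_quotient])
       (use m s1 in \<open>auto intro!: continuous_intros\<close>)
  have posH: "H x > 0" for x
  proof (cases "(sin x)\<^sup>2 = 1")
    case False
    then have "(sin x)\<^sup>2 < 1" using s1[of x] by simp
    moreover from this have "((sin x)\<^sup>2) powr (m / 2) < 1 powr (m / 2)"
      using m by (intro powr_less_mono2) auto
    ultimately show ?thesis by (simp add: H_def h_def)
  qed (use m in \<open>simp add: H_def h_def\<close>)
  have cosH: "(cos x)\<^sup>2 * H x = 1 - \<bar>sin x\<bar> powr m" for x
  proof -
    have "((sin x)\<^sup>2) powr (m / 2) = \<bar>sin x\<bar> powr m"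
    proof (cases "sin x = 0")
      case False
      then show ?thesis using powr_powr[of "\<bar>sin x\<bar>" 2 "m / 2"] by simp
    qed (use m in auto)
    moreover have "\<bar>sin x\<bar> = 1" if "(sin x)\<^sup>2 = 1" using that by (auto simp: power2_eq_1_iff)
    ultimately show ?thesis
      by (auto simp: H_def h_def cos_squared_eq)
  qed
  obtain n :: nat where n: "\<nu> < n" using reals_Archimedean2 by blast
  then have n0: "n > 0" using \<nu> by (cases n) auto
  obtain D where D: "D > 0" "integral {0..2 * pi} (\<lambda>x. 1 / sqrt (\<nu>\<^sup>2 + D * H x)) = 2 * pi / n"
    using exists_stiffness[OF contH posH \<nu> n] by blast
  define G where "G x = sqrt (\<nu>\<^sup>2 + D * H x)" for x
  have rad: "\<nu>\<^sup>2 + D * H x > 0" for x using D(1) \<nu> posH[of x] by (simp add: add_pos_pos)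
  have contG: "continuous_on UNIV G" unfolding G_def by (intro continuous_intros contH)
  have posG: "G x > 0" for x using rad by (simp add: G_def)
  have G2: "(G x)\<^sup>2 = \<nu>\<^sup>2 + D * H x" for x using rad[of x] by (simp add: G_def)
  obtain \<theta> where \<theta>: "\<And>t. (\<theta> has_real_derivative G (\<theta> t)) (at t)" "\<And>t. \<theta> (- t) = - \<theta> t"
    "\<And>t. \<theta> (t + 2 * pi) = \<theta> t + 2 * pi * n" "surj \<theta>"
    by (rule exists_phase[OF contG posG _ _ n0]) (use D(2) in \<open>auto simp: G_def H_def\<close>)
  define V where "V t = sin (\<theta> t)" for t
  define V' where "V' t = cos (\<theta> t) * G (\<theta> t)" for t
  define R where "R v = - \<nu>\<^sup>2 * v - D * m / 2 * (sgn v * \<bar>v\<bar> powr (m - 1))" for v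
  define P where "P v = \<nu>\<^sup>2 * (1 - v\<^sup>2) + D * (1 - \<bar>v\<bar> powr m)" for v
  have dV: "(V has_real_derivative V' t) (at t)" for t
    unfolding V_def V'_def by (auto intro!: derivative_eq_intros \<theta>)
  have dP: "(P has_real_derivative 2 * R v) (at v)" for v
    unfolding P_def R_def
    by (rule derivative_eq_intros has_derivative_abs_powr[OF m] refl | simp add: algebra_simps)+
  have energy: "(V' t)\<^sup>2 = P (V t)" for t
  proof -
    have "(V' t)\<^sup>2 = \<nu>\<^sup>2 * (cos (\<theta> t))\<^sup>2 + D * ((cos (\<theta> t))\<^sup>2 * H (\<theta> t))"
      by (simp add: V'_def power_mult_distrib G2 algebra_simps)
    then show ?thesis unfolding cosH by (simp add: P_def V_def cos_squared_eq)
  qed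
  have contV': "isCont V' t" for t
    unfolding V'_def
    by (intro continuous_intros isCont_o2[of t \<theta> G] DERIV_isCont[OF \<theta>(1)] isCont_o2[of t \<theta> cos])
       (use contG in \<open>auto simp: continuous_on_eq_continuous_at\<close>)
  have contV: "isCont V t" for t using dV DERIV_isCont by blast
  \<comment> \<open>Away from turning points the sign of \<open>V'\<close> is locally constant, so
    \<open>V'\<close> is a signed square root of \<open>P (V t)\<close> and can be
    differentiated.\<close>
  have regular: "(V' has_real_derivative R (V t)) (at t)" if "V' t \<noteq> 0" for t
  proof -
    define \<sigma> where "\<sigma> = sgn (V' t)"
    have Ppos: "P (V t) > 0" using that energy[of t] by (metis zero_less_power2)
    have "((\<lambda>s. P (V s)) has_real_derivative 2 * R (V t) * V' t) (at t)"
      by (rule DERIV_chain2[OF dP dV])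
    then have "((\<lambda>s. \<sigma> * sqrt (P (V s))) has_real_derivative
       \<sigma> * (2 * R (V t) * V' t / (2 * sqrt (P (V t))))) (at t)"
      using Ppos by (auto intro!: derivative_eq_intros simp: field_simps)
    moreover have "sqrt (P (V t)) = \<bar>V' t\<bar>" by (metis energy real_sqrt_abs)
    moreover have "\<sigma> * (2 * R (V t) * V' t / (2 * \<bar>V' t\<bar>)) = R (V t)"
      using that by (simp add: \<sigma>_def sgn_if)
    ultimately have *: "((\<lambda>s. \<sigma> * sqrt (P (V s))) has_real_derivative R (V t)) (at t)" by simp
    have "((\<lambda>s. \<sigma> * V' s) \<longlongrightarrow> \<sigma> * V' t) (nhds t)"
      using contV' by (intro tendsto_intros) (simp add: tendsto_at_iff_tendsto_nhds[symmetric] isCont_def)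
    moreover have "\<sigma> * V' t > 0" using that by (simp add: \<sigma>_def sgn_if)
    ultimately have "eventually (\<lambda>s. \<sigma> * V' s > 0) (nhds t)" by (rule order_tendstoD)
    then have ev: "eventually (\<lambda>s. \<sigma> * sqrt (P (V s)) = V' s) (nhds t)"
    proof eventually_elim
      case (elim s)
      have "sqrt (P (V s)) = \<bar>V' s\<bar>" by (metis energy real_sqrt_abs)
      with elim that show ?case by (auto simp: \<sigma>_def sgn_if split: if_splits)
    qed
    show ?thesis using * DERIV_cong_ev[OF refl ev refl] by blast
  qed
  have contR: "isCont (\<lambda>t. R (V t)) t" for t
  proof -
    have "continuous_on UNIV R"
      unfolding R_def using m by (intro continuous_intros continuous_on_sgn_mult_powr) auto
    then show ?thesis using contV isCont_o2 by (metis UNIV_I continuous_on_eq_continuous_at open_UNIV)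
  qed
  have dV': "(V' has_real_derivative R (V t)) (at t)" for t
  proof (cases "V' t = 0")
    case True
    then have c0: "cos (\<theta> t) = 0" using posG[of "\<theta> t"] by (auto simp: V'_def)
    then have s0: "sin (\<theta> t) \<noteq> 0" using sin_cos_squared_add[of "\<theta> t"] by auto
    \<comment> \<open>At a turning point \<open>cos (\<theta> s)\<close> has nonzero derivative, so
      the turning point is isolated and \<open>regular\<close> holds at all other points
      nearby.\<close>
    have "((\<lambda>s. cos (\<theta> s)) has_real_derivative - sin (\<theta> t) * G (\<theta> t)) (at t)"
      by (auto intro!: derivative_eq_intros \<theta>)
    then have "((\<lambda>s. cos (\<theta> s) / (s - t)) \<longlongrightarrow> - sin (\<theta> t) * G (\<theta> t)) (at t)"
      by (simp add: has_field_derivative_iff c0)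
    then have "eventually (\<lambda>s. cos (\<theta> s) / (s - t) \<noteq> 0) (at t)"
      by (rule tendsto_imp_eventually_ne) (use s0 posG[of "\<theta> t"] in auto)
    then have "eventually (\<lambda>s. (V' has_real_derivative R (V s)) (at s)) (at t)"
    proof eventually_elim
      case (elim s)
      then have "V' s \<noteq> 0" using posG[of "\<theta> s"] by (auto simp: V'_def)
      then show ?case by (rule regular)
    qed
    then show ?thesis
      by (rule has_derivative_at_removable_point[OF contV' _ contR])
  qed (rule regular)
  show ?thesis
  proof (rule that[of D V V'])
    show "(V' has_real_derivative - \<nu>\<^sup>2 * V t - D * m / 2 * (sgn (V t) * \<bar>V t\<bar> powr (m - 1))) (at t)" for t
      using dV'[of t] by (simp add: R_def)
    show "(V' t)\<^sup>2 = \<nu>\<^sup>2 * (1 - (V t)\<^sup>2) + D * (1 - \<bar>V t\<bar> powr m)" for t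
      using energy[of t] by (simp add: P_def)
    show "V (- t) = - V t" for t by (simp add: V_def \<theta>)
    show "V (t + 2 * pi) = V t" for t
      unfolding V_def \<theta>(3) using sin.plus_of_nat[of "\<theta> t" n] by (simp add: mult_ac)
    show "\<exists>t. V t = 1" using \<theta>(4) unfolding V_def by (metis sin_pi_half surjD)
  qed (use D dV in auto)
qed

subsection \<open>Fields with a prescribed angular profile\<close>

text \<open>The vectors \<open>x\<close> and \<open>perp x\<close> already have length
  \<open>norm x\<close>, hence the exponent \<open>- \<alpha> - 1\<close> in a field of degree
  \<open>- \<alpha>\<close>.\<close>

definition polar_field :: "real \<Rightarrow> (real \<Rightarrow> real) \<Rightarrow> (real \<Rightarrow> real) \<Rightarrow> real ^ 2 \<Rightarrow> real ^ 2" where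
  "polar_field \<alpha> U V x = norm x powr (- \<alpha> - 1) *\<^sub>R (U (angle x) *\<^sub>R x + V (angle x) *\<^sub>R perp x)"

lemma Ck_on_polar_field:
  assumes "Ck_on k UNIV U" "Ck_on k UNIV V"
    "\<And>t. U (t + 2 * pi) = U t" "\<And>t. V (t + 2 * pi) = V t"
  shows "Ck_on k punctured_plane (polar_field \<alpha> U V)"
proof -
  have "Ck_on k punctured_plane (\<lambda>x. U (angle x))" "Ck_on k punctured_plane (\<lambda>x. V (angle x))"
    using assms by (auto intro: Ck_on_periodic_angle)
  moreover have "Ck_on k punctured_plane (\<lambda>x. x)" "Ck_on k punctured_plane perp"
    by (auto intro: Ck_on_bounded_linear bounded_linear_ident bounded_linear_perp)
  ultimately show ?thesis
    unfolding polar_field_def[abs_def]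
    by (intro Ck_on_scaleR Ck_on_add Ck_on_norm_powr) auto
qed

text \<open>The converse of \<open>polar_system\<close>, computed at every nonzero point: once the
  derivative is explicit, each equation reduces to a polynomial identity modulo the angular equation
  and the relation \<open>IN\<close>.\<close>

lemma polar_field_system:
  assumes U: "\<And>t. U (t + 2 * pi) = U t" and V: "\<And>t. V (t + 2 * pi) = V t"
    and dU: "\<And>t. (U has_real_derivative U' t) (at t)"
    and dV: "\<And>t. (V has_real_derivative (\<alpha> - 1) * U t) (at t)"
    and eq: "\<And>t. V t * U' t = \<alpha> * (U t)\<^sup>2 + (V t)\<^sup>2 + 2 * \<alpha> * c"
  shows "classical_euler_on punctured_plane (polar_field \<alpha> U V) (\<lambda>x. c * norm x powr (- 2 * \<alpha>))"
    and "x \<noteq> 0 \<Longrightarrow> vorticity (polar_field \<alpha> U V) x =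
      norm x powr (- \<alpha> - 1) * ((1 - \<alpha>) * V (angle x) - U' (angle x))"
proof -
  define s where "s = - \<alpha> - 1"
  let ?u = "polar_field \<alpha> U V"
  define R where "R x = norm x powr s" for x :: "real ^ 2"
  define I where "I x = norm x powr - 2" for x :: "real ^ 2"
  \<comment> \<open>The product rule applied to \<open>polar_field\<close>, with the powers of the
    norm kept as the atoms \<open>R x\<close> and \<open>I x\<close>.\<close>
  define Du where "Du x v = (s * (R x * I x) * (x \<bullet> v)) *\<^sub>R (U (angle x) *\<^sub>R x + V (angle x) *\<^sub>R perp x)
    + R x *\<^sub>R ((U' (angle x) * (I x * (perp x \<bullet> v))) *\<^sub>R x + U (angle x) *\<^sub>R v +
       ((\<alpha> - 1) * U (angle x) * (I x * (perp x \<bullet> v))) *\<^sub>R perp x + V (angle x) *\<^sub>R perp v)" for x v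
  define Dp where "Dp x v = c * (- 2 * \<alpha>) * (R x)\<^sup>2 * (x \<bullet> v)" for x v :: "real ^ 2"
  have RI: "norm x powr (s - 2) = R x * I x" if "x \<noteq> 0" for x :: "real ^ 2"
    by (simp add: R_def I_def powr_add[symmetric])
  have RR: "norm x powr (- 2 * \<alpha> - 2) = (R x)\<^sup>2" if "x \<noteq> 0" for x :: "real ^ 2"
    by (simp add: R_def s_def power2_eq_square powr_add[symmetric])
  have IN: "I x * ((x $ 1)\<^sup>2 + (x $ 2)\<^sup>2) = 1" if "x \<noteq> 0" for x :: "real ^ 2"
    using that unfolding I_def norm_real2[symmetric] by (simp add: powr_minus)
  have du: "(?u has_derivative Du x) (at x)" if "x \<noteq> 0" for x
  proof -
    note [derivative_intros] = has_derivative_periodic_angle[OF U dU that]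
      has_derivative_periodic_angle[OF V dV that] has_derivative_norm_powr[OF that]
      bounded_linear.has_derivative[OF bounded_linear_perp]
    show ?thesis
      unfolding polar_field_def[abs_def] s_def[symmetric] Du_def[abs_def]
      by (rule derivative_eq_intros refl)+
         (simp add: fun_eq_iff RI[OF that] I_def[symmetric] R_def[symmetric] scaleR_add_right add_ac)
  qed
  have dp: "((\<lambda>x. c * norm x powr (- 2 * \<alpha>)) has_derivative Dp x) (at x)" if "x \<noteq> 0" for x :: "real ^ 2"
    using has_derivative_mult_right[OF has_derivative_norm_powr[OF that, of "- 2 * \<alpha>"], of c]
    unfolding Dp_def[abs_def] RR[OF that] by (simp add: mult_ac)
  have u: "?u x = R x *\<^sub>R (U (angle x) *\<^sub>R x + V (angle x) *\<^sub>R perp x)" for x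
    by (simp add: polar_field_def R_def s_def)
  have mom: "Du x (?u x) $ j + Dp x (axis j 1) = 0" if "x \<noteq> 0" for x j
  proof -
    have 1: "x \<bullet> ?u x = R x * U (angle x) * ((x $ 1)\<^sup>2 + (x $ 2)\<^sup>2)"
      "perp x \<bullet> ?u x = R x * V (angle x) * ((x $ 1)\<^sup>2 + (x $ 2)\<^sup>2)"
      unfolding u by (simp_all add: inner_real2 power2_eq_square algebra_simps)
    have 2: "R x * I x * (R x * y * ((x $ 1)\<^sup>2 + (x $ 2)\<^sup>2)) = (R x)\<^sup>2 * y"
      "I x * (R x * y * ((x $ 1)\<^sup>2 + (x $ 2)\<^sup>2)) = R x * y" for y
      using IN[OF that] by algebra+
    have 3: "s * (R x * I x) * (x \<bullet> ?u x) = s * (R x)\<^sup>2 * U (angle x)"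
      "I x * (perp x \<bullet> ?u x) = R x * V (angle x)"
      unfolding 1 using 2 by (simp_all add: mult.assoc)
    have "Du x (?u x) $ 1 + Dp x (axis 1 1) = 0"
      unfolding Du_def 3 Dp_def
      apply (simp add: u inner_real2)
      using eq[of "angle x"] unfolding s_def
      by algebra
    moreover have "Du x (?u x) $ 2 + Dp x (axis 2 1) = 0"
      unfolding Du_def 3 Dp_def
      apply (simp add: u inner_real2)
      using eq[of "angle x"] unfolding s_def
      by algebra
    ultimately show ?thesis using exhaust_2[of j] by auto
  qed
  have div: "Du x (axis 1 1) $ 1 + Du x (axis 2 1) $ 2 = 0" if "x \<noteq> 0" for x
    unfolding Du_def
    apply (simp add: inner_real2)
    using IN[OF that] unfolding s_def
    by algebra
  have vort: "Du x (axis 1 1) $ 2 - Du x (axis 2 1) $ 1 = R x * ((1 - \<alpha>) * V (angle x) - U' (angle x))"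
    if "x \<noteq> 0" for x
    unfolding Du_def
    apply (simp add: inner_real2)
    using IN[OF that] unfolding s_def
    by algebra
  show "classical_euler_on punctured_plane ?u (\<lambda>x. c * norm x powr (- 2 * \<alpha>))"
  proof (subst classical_euler_on_iff[of _ _ Du _ Dp])
    fix x assume "x \<in> punctured_plane"
    then show "(?u has_derivative Du x) (at x)" "((\<lambda>x. c * norm x powr (- 2 * \<alpha>)) has_derivative Dp x) (at x)"
      by (intro du dp; simp)+
  qed (use mom div in auto)
  show "x \<noteq> 0 \<Longrightarrow> vorticity ?u x =
      norm x powr (- \<alpha> - 1) * ((1 - \<alpha>) * V (angle x) - U' (angle x))"
    using vort[of x] by (simp add: vorticity_eq[OF du] R_def s_def)
qed

lemma polar_field_zero [simp]: "polar_field \<alpha> U V 0 = 0"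
  by (simp add: polar_field_def)

lemma polar_field_scale:
  assumes U: "\<And>t. U (t + 2 * pi) = U t" and V: "\<And>t. V (t + 2 * pi) = V t" and l: "l > 0"
  shows "polar_field \<alpha> U V (l *\<^sub>R x) = l powr - \<alpha> *\<^sub>R polar_field \<alpha> U V x"
proof (cases "x = 0")
  case False
  have "l *\<^sub>R x = (l * norm x) *\<^sub>R circ (angle x)" using angle[of x] by (metis scaleR_scaleR)
  then have "U (angle (l *\<^sub>R x)) = U (angle x)" "V (angle (l *\<^sub>R x)) = V (angle x)"
    using False l by (auto intro: periodic_angle[of U, OF U] periodic_angle[of V, OF V])
  moreover have "perp (l *\<^sub>R x) = l *\<^sub>R perp x" by (simp add: vec_eq_real2)
  moreover have "l powr - \<alpha> = l powr (- \<alpha> - 1) * l"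
    using l by (simp add: powr_diff)
  ultimately show ?thesis
    using l by (simp add: polar_field_def powr_mult scaleR_add_right mult_ac)
qed simp

lemma reflection_symmetric_polar_field:
  assumes U: "\<And>t. U (t + 2 * pi) = U t" and V: "\<And>t. V (t + 2 * pi) = V t"
    and sym: "\<And>t. U (- t) = U t" "\<And>t. V (- t) = - V t"
  shows "reflection_symmetric_on S (polar_field \<alpha> U V) (\<lambda>x. c * norm x powr a)"
  unfolding reflection_symmetric_on_def
proof (intro ballI)
  fix x
  have n: "norm (reflect x) = norm x"
    by (rule power2_eq_imp_eq) (simp_all add: norm_real2)
  show "polar_field \<alpha> U V x $ 1 = polar_field \<alpha> U V (reflect x) $ 1 \<and>
    polar_field \<alpha> U V x $ 2 = - polar_field \<alpha> U V (reflect x) $ 2 \<and>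
    c * norm x powr a = c * norm (reflect x) powr a"
  proof (cases "x = 0")
    case True
    moreover from this have "reflect x = 0" by (simp add: vec_eq_real2)
    ultimately show ?thesis by simp
  next
    case False
    have "x $ 1 = norm x * cos (angle x)" "x $ 2 = norm x * sin (angle x)"
      using angle[of x] by (metis circ_nth vector_scaleR_component real_scaleR_def)+
    then have "reflect x = norm x *\<^sub>R circ (- angle x)"
      by (simp add: vec_eq_real2)
    then have "U (angle (reflect x)) = U (angle x)" "V (angle (reflect x)) = - V (angle x)"
      using False periodic_angle[of U, OF U, of "reflect x"] periodic_angle[of V, OF V, of "reflect x"]
      by (metis sym zero_less_norm_iff)+
    then show ?thesis by (simp add: polar_field_def n algebra_simps)
  qed
qed

text \<open>The set \<open>S\<close> is arbitrary because field and pressure take the value zero at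
  the origin, where homogeneity and symmetry are then trivial. A single angle with nonzero vorticity
  makes the field rotational.\<close>

lemma admissible_polar_field:
  assumes U: "\<And>t. U (t + 2 * pi) = U t" and V: "\<And>t. V (t + 2 * pi) = V t"
    and sym: "\<And>t. U (- t) = U t" "\<And>t. V (- t) = - V t"
    and dU: "\<And>t. (U has_real_derivative U' t) (at t)"
    and dV: "\<And>t. (V has_real_derivative (\<alpha> - 1) * U t) (at t)"
    and eq: "\<And>t. V t * U' t = \<alpha> * (U t)\<^sup>2 + (V t)\<^sup>2 + 2 * \<alpha> * c"
    and rot: "(1 - \<alpha>) * V t \<noteq> U' t"
  shows "admissible_on \<alpha> S (polar_field \<alpha> U V) (\<lambda>x. c * norm x powr (- 2 * \<alpha>))"
proof -
  have "homogeneous_on \<alpha> S (polar_field \<alpha> U V) (\<lambda>x. c * norm x powr (- 2 * \<alpha>))"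
    unfolding homogeneous_on_def
  proof (intro ballI allI impI conjI)
    fix x :: "real ^ 2" and l :: real assume l: "l > 0"
    show "polar_field \<alpha> U V x = l powr \<alpha> *\<^sub>R polar_field \<alpha> U V (l *\<^sub>R x)"
      using l by (simp add: polar_field_scale[of U V, OF U V] powr_add[symmetric])
    show "c * norm x powr (- 2 * \<alpha>) = l powr (2 * \<alpha>) * (c * norm (l *\<^sub>R x) powr (- 2 * \<alpha>))"
      using l by (simp add: powr_mult powr_minus)
  qed
  moreover have "scaled_pressure_const \<alpha> (\<lambda>x. c * norm x powr (- 2 * \<alpha>))"
    unfolding scaled_pressure_const_def
    by (rule exI[of _ c]) (simp add: powr_minus)
  moreover have "vorticity (polar_field \<alpha> U V) (circ t) = (1 - \<alpha>) * V t - U' t"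
  proof -
    \<comment> \<open>Periodicity is needed since \<open>angle (circ t)\<close> may differ from
      \<open>t\<close> by full turns.\<close>
    have "U' (s + 2 * pi) = U' s" for s
    proof -
      have "((\<lambda>s. U (s + 2 * pi)) has_real_derivative U' (s + 2 * pi)) (at s)"
        using DERIV_shift[of U "U' (s + 2 * pi)" s "2 * pi"] dU by simp
      then show ?thesis unfolding U using dU DERIV_unique by blast
    qed
    then have "(1 - \<alpha>) * V (angle (circ t)) - U' (angle (circ t)) = (1 - \<alpha>) * V t - U' t"
      by (intro periodic_angle[of "\<lambda>t. (1 - \<alpha>) * V t - U' t" _ 1]) (simp_all add: V)
    then show ?thesis
      using polar_field_system(2)[OF U V dU dV eq, of "circ t"] by simp
  qed
  then have "rotational (polar_field \<alpha> U V)"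
    unfolding irrotational_def using rot by (auto intro!: bexI[of _ "circ t"])
  ultimately show ?thesis
    unfolding admissible_on_def
    using reflection_symmetric_polar_field[of U V, OF U V sym] by blast
qed

text \<open>The oscillator provides \<open>V\<close>, and \<open>V' = (\<alpha> - 1) * U\<close>
  dictates \<open>U\<close>. Since \<open>m > 2\<close> for \<open>\<alpha> > 1\<close>, the
  restoring force is then \<open>C^1\<close> along the solution, which gives the extra
  derivative.\<close>

lemma exists_angular_profile:
  assumes \<alpha>: "\<bar>\<alpha>\<bar> > 1"
  obtains U V U' :: "real \<Rightarrow> real" and c t where
    "\<And>t. U (t + 2 * pi) = U t" "\<And>t. V (t + 2 * pi) = V t"
    "\<And>t. U (- t) = U t" "\<And>t. V (- t) = - V t"
    "\<And>t. (U has_real_derivative U' t) (at t)"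
    "\<And>t. (V has_real_derivative (\<alpha> - 1) * U t) (at t)"
    "\<And>t. V t * U' t = \<alpha> * (U t)\<^sup>2 + (V t)\<^sup>2 + 2 * \<alpha> * c"
    "(1 - \<alpha>) * V t \<noteq> U' t"
    "Ck_on (if \<alpha> > 1 then 2 else 1) UNIV U" "Ck_on (if \<alpha> > 1 then 2 else 1) UNIV V"
proof -
  define \<beta> where "\<beta> = \<alpha> - 1"
  define m where "m = 2 * \<alpha> / \<beta>"
  have \<beta>: "\<beta> \<noteq> 0" using \<alpha> by (auto simp: \<beta>_def)
  have m: "m > 1"
    using \<alpha> by (cases "\<alpha> > 0") (auto simp: m_def \<beta>_def field_simps abs_if split: if_splits)
  have m2: "m > 2" if "\<alpha> > 1"
    using that by (auto simp: m_def \<beta>_def field_simps)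
  obtain D V V' where D: "D > 0"
    and dV: "\<And>t. (V has_real_derivative V' t) (at t)"
    and dV': "\<And>t. (V' has_real_derivative - \<bar>\<beta>\<bar>\<^sup>2 * V t - D * m / 2 * (sgn (V t) * \<bar>V t\<bar> powr (m - 1))) (at t)"
    and energy: "\<And>t. (V' t)\<^sup>2 = \<bar>\<beta>\<bar>\<^sup>2 * (1 - (V t)\<^sup>2) + D * (1 - \<bar>V t\<bar> powr m)"
    and odd: "\<And>t. V (- t) = - V t" and per: "\<And>t. V (t + 2 * pi) = V t" and amp: "\<exists>t. V t = 1"
    using exists_periodic_oscillation[OF _ m, of "\<bar>\<beta>\<bar>"] \<beta> unfolding zero_less_abs_iff by blast
  define R where "R t = - \<bar>\<beta>\<bar>\<^sup>2 * V t - D * m / 2 * (sgn (V t) * \<bar>V t\<bar> powr (m - 1))" for t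
  \<comment> \<open>Inserting the energy identity into
    \<open>\<alpha> * U\<^sup>2 + V\<^sup>2 + 2 * \<alpha> * c\<close> leaves a constant term, and
    this value cancels it.\<close>
  define c where "c = - (\<beta>\<^sup>2 + D) / (2 * \<beta>\<^sup>2)"
  define U where "U t = V' t / \<beta>" for t
  define U' where "U' t = R t / \<beta>" for t
  have dR: "(V' has_real_derivative R t) (at t)" for t using dV' by (simp add: R_def)
  have V'_per: "V' (t + 2 * pi) = V' t" for t
  proof -
    have "((\<lambda>t. V (t + 2 * pi)) has_real_derivative V' (t + 2 * pi)) (at t)"
      using DERIV_shift[of V "V' (t + 2 * pi)" t "2 * pi"] dV by simp
    then show ?thesis unfolding per using dV DERIV_unique by blast
  qed
  have V'_even: "V' (- t) = V' t" for t
  proof -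
    have "((\<lambda>t. V (- t)) has_real_derivative - V' (- t)) (at t)"
      using DERIV_mirror[of V "V' (- t)" t] dV by simp
    moreover have "((\<lambda>t. V (- t)) has_real_derivative - V' t) (at t)"
      unfolding odd by (intro DERIV_minus dV)
    ultimately show ?thesis using DERIV_unique by fastforce
  qed
  have dU: "(U has_real_derivative U' t) (at t)" for t
    unfolding U_def U'_def by (intro DERIV_cdivide dR)
  have eq: "V t * U' t = \<alpha> * (U t)\<^sup>2 + (V t)\<^sup>2 + 2 * \<alpha> * c" for t
  proof -
    define P where "P = \<bar>V t\<bar> powr m"
    define I where "I = 1 / \<beta>"
    have I: "\<beta> * I = 1" using \<beta> by (simp add: I_def)
    define S where "S = sgn (V t) * \<bar>V t\<bar> powr (m - 1)"
    have VS: "V t * S = P"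
      by (cases "V t" "0::real" rule: linorder_cases) (auto simp: P_def S_def powr_diff)
    have "D * m / 2 = D * \<alpha> * I" by (simp add: m_def I_def)
    then have RS: "R t = - \<beta>\<^sup>2 * V t - D * \<alpha> * I * S"
      by (simp only: R_def S_def power2_abs)
    have "V t * R t = - \<beta>\<^sup>2 * (V t)\<^sup>2 - D * \<alpha> * I * (V t * S)"
      unfolding RS by (simp add: algebra_simps power2_eq_square)
    then have VR: "V t * R t = - \<beta>\<^sup>2 * (V t)\<^sup>2 - D * \<alpha> * I * P"
      unfolding VS .
    have "(V' t)\<^sup>2 = \<beta>\<^sup>2 * (1 - (V t)\<^sup>2) + D * (1 - P)"
      using energy[of t] by (simp add: P_def)
    moreover have "2 * c = - (\<beta>\<^sup>2 + D) * I\<^sup>2"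
      using \<beta> by (simp add: c_def I_def power2_eq_square field_simps)
    moreover have "U t = V' t * I" "U' t = R t * I" by (simp_all add: U_def U'_def I_def)
    moreover have "\<alpha> = \<beta> + 1" by (simp add: \<beta>_def)
    ultimately show ?thesis using VR I by algebra
  qed
  have contV: "continuous_on S V" for S
    using dV by (meson DERIV_isCont continuous_at_imp_continuous_on)
  have C0: "Ck_on 0 UNIV R"
    unfolding R_def[abs_def] using m
    by (auto intro!: continuous_intros contV continuous_on_compose2[OF continuous_on_sgn_mult_powr[of "m - 1" UNIV] contV])
  have C1: "Ck_on 1 UNIV R" if "\<alpha> > 1"
    unfolding One_nat_def
  proof (rule Ck_on_Suc_real)
    show "(R has_real_derivative - \<beta>\<^sup>2 * V' t - D * m / 2 * ((m - 1) * \<bar>V t\<bar> powr (m - 2) * V' t)) (at t)" for t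
    proof -
      have "((\<lambda>t. sgn (V t) * \<bar>V t\<bar> powr (m - 1)) has_real_derivative (m - 1) * \<bar>V t\<bar> powr (m - 1 - 1) * V' t) (at t)"
        by (rule DERIV_chain2[OF has_derivative_sgn_mult_powr dV]) (use m2[OF that] in simp)
      from DERIV_diff[OF DERIV_cmult[OF dV, of "- \<beta>\<^sup>2"] DERIV_cmult[OF this, of "D * m / 2"]]
      show ?thesis by (simp add: R_def[abs_def])
    qed
    have "continuous_on UNIV V'" using dR by (meson DERIV_isCont continuous_at_imp_continuous_on)
    then show "Ck_on 0 UNIV (\<lambda>t. - \<beta>\<^sup>2 * V' t - D * m / 2 * ((m - 1) * \<bar>V t\<bar> powr (m - 2) * V' t))"
      using m2[OF that] by (auto intro!: continuous_intros continuous_on_powr' contV)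
  qed
  \<comment> \<open>The force \<open>R\<close> is of class \<open>C^k\<close>; integrating it once
    gives \<open>U\<close> in \<open>C^(k+1)\<close>, and twice gives \<open>V\<close> in
    \<open>C^(k+2)\<close>.\<close>
  define k :: nat where "k = (if \<alpha> > 1 then 1 else 0)"
  have Ck: "Ck_on k UNIV R" using C0 C1 by (simp add: k_def)
  have k: "(if \<alpha> > 1 then 2 else 1) = Suc k" by (simp add: k_def)
  have CU: "Ck_on (Suc k) UNIV U"
    using Ck_on_mult[OF Ck_on_const Ck, of "1 / \<beta>"] by (intro Ck_on_Suc_real[OF dU]) (simp add: U'_def[abs_def])
  have CV: "Ck_on (Suc k) UNIV V"
    by (rule Ck_on_Suc_imp[OF Ck_on_Suc_real[OF dV Ck_on_Suc_real[OF dR Ck]]])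
  obtain t where t: "V t = 1" using amp by blast
  show ?thesis
  proof (rule that[of U V U' c t], unfold k)
    \<comment> \<open>At an angle of maximal \<open>V\<close> the vorticity equals
      \<open>D * \<alpha> / \<beta>\<^sup>2\<close>; it is the positive stiffness \<open>D\<close>
      that makes the flow rotational.\<close>
    show "(1 - \<alpha>) * V t \<noteq> U' t"
    proof -
      have "U' t = - \<beta> - D * \<alpha> / \<beta>\<^sup>2"
        using \<beta> by (simp add: U'_def R_def m_def t field_simps power2_eq_square)
      moreover have "D * \<alpha> / \<beta>\<^sup>2 \<noteq> 0" using D \<alpha> \<beta> by auto
      ultimately show ?thesis using t by (simp add: \<beta>_def)
    qed
    show "(V has_real_derivative (\<alpha> - 1) * U t) (at t)" for t
      using dV[of t] \<beta> by (simp add: U_def \<beta>_def)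
  qed (use dU eq CU CV per odd V'_per V'_even in \<open>auto simp: U_def\<close>)
qed

subsection \<open>Distributional solutions across the origin\<close>

text \<open>Compactness bounds \<open>f\<close> on the unit sphere, and scaling carries the bound to
  all other points.\<close>

lemma homogeneous_bound:
  fixes f :: "'a::euclidean_space \<Rightarrow> 'b::real_normed_vector"
  assumes cont: "continuous_on (UNIV - {0}) f"
    and hom: "\<And>x l. x \<noteq> 0 \<Longrightarrow> l > 0 \<Longrightarrow> f (l *\<^sub>R x) = l powr a *\<^sub>R f x"
  obtains M where "M > 0" "\<And>x. x \<noteq> 0 \<Longrightarrow> norm (f x) \<le> M * norm x powr a"
proof -
  have "continuous_on (sphere 0 1) f"
    by (rule continuous_on_subset[OF cont]) auto
  then have "bounded (f ` sphere 0 1)"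
    by (intro compact_imp_bounded compact_continuous_image compact_sphere)
  then obtain M where M: "M > 0" "\<And>x. norm x = 1 \<Longrightarrow> norm (f x) \<le> M"
    unfolding bounded_pos by auto
  have "norm (f x) \<le> M * norm x powr a" if "x \<noteq> 0" for x
  proof -
    have "f x = f (norm x *\<^sub>R sgn x)" using that by (simp add: sgn_div_norm)
    also have "\<dots> = norm x powr a *\<^sub>R f (sgn x)"
      using that by (intro hom) (auto simp: sgn_zero_iff)
    finally have "norm (f x) = norm x powr a * norm (f (sgn x))" by simp
    also have "\<dots> \<le> norm x powr a * M"
      using M(2)[of "sgn x"] that by (intro mult_left_mono) (auto simp: norm_sgn)
    finally show ?thesis by (simp add: mult.commute)
  qed
  with M(1) show ?thesis by (rule that)
qed

lemma tendsto_norm_powr_zero: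
  assumes "a > 0"
  shows "((\<lambda>x::'a::real_normed_vector. M * norm x powr a) \<longlongrightarrow> 0) (at 0)"
proof -
  have "continuous_on UNIV (\<lambda>x::'a. M * norm x powr a)"
    using assms by (auto intro!: continuous_intros continuous_on_powr')
  then show ?thesis unfolding continuous_on_def by (auto dest!: spec[of _ 0])
qed

lemma homogeneous_has_derivative_zero:
  fixes f :: "'a::euclidean_space \<Rightarrow> 'b::real_normed_vector"
  assumes cont: "continuous_on (UNIV - {0}) f" and f0: "f 0 = 0" and a: "a > 1"
    and hom: "\<And>x l. x \<noteq> 0 \<Longrightarrow> l > 0 \<Longrightarrow> f (l *\<^sub>R x) = l powr a *\<^sub>R f x"
  shows "(f has_derivative (\<lambda>_. 0)) (at 0)"
proof -
  obtain M where M: "M > 0" "\<And>x. x \<noteq> 0 \<Longrightarrow> norm (f x) \<le> M * norm x powr a"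
    using homogeneous_bound[OF cont hom] by blast
  have "((\<lambda>h. norm (f h) / norm h) \<longlongrightarrow> 0) (at 0)"
  proof (rule tendsto_sandwich[OF _ _ tendsto_const tendsto_norm_powr_zero[of "a - 1" M]])
    show "\<forall>\<^sub>F h in at 0. norm (f h) / norm h \<le> M * norm h powr (a - 1)"
      unfolding eventually_at_filter
      using M(2) by (intro always_eventually allI impI) (simp add: powr_diff divide_right_mono)
  qed (use a in \<open>auto intro!: always_eventually\<close>)
  then show ?thesis by (simp add: has_derivative_at f0)
qed

text \<open>The derivative has positive degree \<open>a - 1\<close>, so it tends to zero at the
  origin, in agreement with the zero derivative of \<open>f\<close> there.\<close>

lemma Ck_on_homogeneous_UNIV:
  fixes f :: "'a::euclidean_space \<Rightarrow> 'b::real_normed_vector"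
  assumes C1: "Ck_on 1 (UNIV - {0}) f" and f0: "f 0 = 0" and a: "a > 1"
    and hom: "\<And>x l. l > 0 \<Longrightarrow> f (l *\<^sub>R x) = l powr a *\<^sub>R f x"
  shows "Ck_on 1 UNIV f"
proof -
  define D where "D x = frechet_derivative f (at x)" for x
  have D: "(f has_derivative D x) (at x)" if "x \<noteq> 0" for x
    unfolding D_def by (rule Ck_on_1_has_derivative[OF C1]) (use that in simp)
  have contD: "continuous_on (UNIV - {0}) (\<lambda>x. D x v)" for v
    using C1 by (simp add: D_def)
  have D0: "(f has_derivative (\<lambda>_. 0)) (at 0)"
    using C1 Ck_on_le[of 1 _ f 0] by (intro homogeneous_has_derivative_zero[OF _ f0 a hom]) auto
  then have D0': "D 0 = (\<lambda>_. 0)" unfolding D_def using frechet_derivative_at by metis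
  have "continuous_on UNIV (\<lambda>x. D x v)" for v
  proof -
    have "D (l *\<^sub>R x) v = l powr (a - 1) *\<^sub>R D x v" if "x \<noteq> 0" "l > 0" for x l
      by (rule homogeneous_derivative_scale[OF D D, of _ _ UNIV]) (use that hom in auto)
    then obtain M where M: "\<And>x. x \<noteq> 0 \<Longrightarrow> norm (D x v) \<le> M * norm x powr (a - 1)"
      using homogeneous_bound[OF contD] by metis
    have "((\<lambda>x. D x v) \<longlongrightarrow> 0) (at 0)"
    proof (rule Lim_null_comparison[OF _ tendsto_norm_powr_zero[of "a - 1" M]])
      show "\<forall>\<^sub>F x in at 0. norm (D x v) \<le> M * norm x powr (a - 1)"
        unfolding eventually_at_filter using M by (intro always_eventually) blast
    qed (use a in simp)
    then have "isCont (\<lambda>x. D x v) 0" by (simp add: isCont_def D0')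
    moreover have "isCont (\<lambda>x. D x v) x" if "x \<noteq> 0" for x
      using contD[of v] that by (simp add: continuous_on_eq_continuous_at open_delete)
    ultimately show ?thesis by (metis continuous_at_imp_continuous_on)
  qed
  moreover have "f differentiable (at x)" for x
    using D D0 differentiableI by (cases "x = 0") blast+
  ultimately show ?thesis by (simp add: D_def)
qed

text \<open>Difference quotients in direction \<open>v\<close> integrate to zero by translation invariance.\<close>

lemma integral_directional_derivative_zero:
  fixes F :: "'a::euclidean_space \<Rightarrow> real"
  assumes F: "Ck_on 1 UNIV F" and supp: "\<And>x. norm x > R \<Longrightarrow> F x = 0"
  shows "integrable lborel (\<lambda>x. frechet_derivative F (at x) v)"
    and "(\<integral>x. frechet_derivative F (at x) v \<partial>lborel) = 0"
proof -
  define D where "D x = frechet_derivative F (at x)" for x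
  have D: "(F has_derivative D x) (at x)" for x
    unfolding D_def by (rule Ck_on_1_has_derivative[OF F UNIV_I])
  have contD: "continuous_on UNIV (\<lambda>x. D x v)"
    using F by (simp add: D_def)
  have contF: "continuous_on UNIV F" using Ck_on_le[OF F, of 0] by simp
  \<comment> \<open>Outside the ball \<open>F\<close> vanishes on an open set. Together with
    compactness of the ball this bounds \<open>D x v\<close> globally.\<close>
  have D0: "D x v = 0" if "norm x > R" for x
  proof -
    have "((\<lambda>_. 0) has_derivative D x) (at x)"
      by (rule has_derivative_transform_within_open[OF D, of "{x. norm x > R}" x])
         (use that supp in \<open>auto intro!: open_Collect_less continuous_intros\<close>)
    then show ?thesis using has_derivative_unique[OF has_derivative_const] by metis
  qed
  have "bounded ((\<lambda>x. D x v) ` cball 0 R)"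
    by (intro compact_imp_bounded compact_continuous_image continuous_on_subset[OF contD]) auto
  then obtain M where M: "M > 0" "\<And>x. norm x \<le> R \<Longrightarrow> \<bar>D x v\<bar> \<le> M"
    unfolding bounded_pos by auto
  have DM: "\<bar>D x v\<bar> \<le> M" for x using M D0[of x] by (cases "norm x \<le> R") auto
  have intF: "integrable lborel F"
  proof -
    have "integrable lborel (\<lambda>x. indicator (cball 0 R) x *\<^sub>R F x)"
      by (intro borel_integrable_compact continuous_on_subset[OF contF]) auto
    moreover have "(\<lambda>x. indicator (cball 0 R) x *\<^sub>R F x) = F"
      using supp by (auto simp: indicator_def fun_eq_iff)
    ultimately show ?thesis by metis
  qed
  define G where "G n x = (F (x + (1 / real (Suc n)) *\<^sub>R v) - F x) * real (Suc n)" for n x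
  have shift: "integrable lborel (\<lambda>x. F (x + h))" "(\<integral>x. F (x + h) \<partial>lborel) = (\<integral>x. F x \<partial>lborel)" for h
  proof -
    have m: "F \<in> borel_measurable borel" using contF by (rule borel_measurable_continuous_onI)
    have "integrable (distr lborel borel ((+) h)) F" using intF by (simp add: lborel_distr_plus)
    then show "integrable lborel (\<lambda>x. F (x + h))"
      using m by (subst (asm) integrable_distr_eq) (auto simp: add.commute)
    have "(\<integral>x. F x \<partial>lborel) = (\<integral>x. F x \<partial>distr lborel borel ((+) h))" by (simp add: lborel_distr_plus)
    also have "\<dots> = (\<integral>x. F (x + h) \<partial>lborel)"
      using m by (subst integral_distr) (auto simp: add.commute)
    finally show "(\<integral>x. F (x + h) \<partial>lborel) = (\<integral>x. F x \<partial>lborel)" by simp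
  qed
  have intG: "integrable lborel (G n)" "integral\<^sup>L lborel (G n) = 0" for n
    unfolding G_def using shift intF by (simp_all add: Bochner_Integration.integral_diff)
  have lim: "(\<lambda>n. G n x) \<longlonglongrightarrow> D x v" for x
  proof -
    have "((\<lambda>t. x + t *\<^sub>R v) has_derivative (\<lambda>t. t *\<^sub>R v)) (at 0)"
      by (auto intro!: derivative_eq_intros)
    then have "((\<lambda>t. F (x + t *\<^sub>R v)) has_derivative (\<lambda>t. D x (t *\<^sub>R v))) (at 0)"
      by (rule has_derivative_compose) (use D in simp)
    moreover have "D x (t *\<^sub>R v) = D x v * t" for t
      using linear_scale[OF has_derivative_linear[OF D]] by simp
    ultimately have "((\<lambda>t. F (x + t *\<^sub>R v)) has_real_derivative D x v) (at 0)"
      by (simp add: has_field_derivative_def fun_eq_iff)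
    then have "((\<lambda>t. (F (x + t *\<^sub>R v) - F x) / t) \<longlongrightarrow> D x v) (at 0)"
      by (simp add: has_field_derivative_iff)
    then have "(\<lambda>n. (F (x + (1 / real (Suc n)) *\<^sub>R v) - F x) / (1 / real (Suc n))) \<longlonglongrightarrow> D x v"
    proof (rule filterlim_compose)
      show "filterlim (\<lambda>n. 1 / real (Suc n)) (at 0) sequentially"
        unfolding filterlim_at by (intro conjI always_eventually LIMSEQ_Suc[OF lim_1_over_n]) auto
    qed
    then show ?thesis by (simp add: G_def)
  qed
  \<comment> \<open>The mean value theorem bounds the quotients by \<open>M\<close>. Steps have
    length at most \<open>norm v\<close>, so enlarging the radius by \<open>norm v\<close> captures
    all supports, and dominated convergence applies.\<close>
  have bound: "\<bar>G n x\<bar> \<le> M * indicator (cball 0 (R + norm v)) x" for n x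
  proof (cases "norm x \<le> R + norm v")
    case True
    have "((\<lambda>t. F (x + t *\<^sub>R v)) has_real_derivative D (x + t *\<^sub>R v) v) (at t)" for t
    proof -
      have "((\<lambda>t. x + t *\<^sub>R v) has_derivative (\<lambda>t. t *\<^sub>R v)) (at t)"
        by (auto intro!: derivative_eq_intros)
      from has_derivative_compose[OF this D]
      have "((\<lambda>t. F (x + t *\<^sub>R v)) has_derivative (\<lambda>s. D (x + t *\<^sub>R v) (s *\<^sub>R v))) (at t)" .
      moreover have "D y (s *\<^sub>R v) = D y v * s" for y s
        using linear_scale[OF has_derivative_linear[OF D]] by simp
      ultimately show ?thesis
        by (simp add: has_field_derivative_def fun_eq_iff)
    qed
    then obtain t where
      "F (x + (1 / real (Suc n)) *\<^sub>R v) - F (x + 0 *\<^sub>R v) = (1 / real (Suc n) - 0) * D (x + t *\<^sub>R v) v"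
      using MVT2[of 0 "1 / real (Suc n)" "\<lambda>t. F (x + t *\<^sub>R v)" "\<lambda>t. D (x + t *\<^sub>R v) v"] by auto
    then have "G n x = D (x + t *\<^sub>R v) v" by (simp add: G_def)
    then show ?thesis using DM True by simp
  next
    case False
    have "norm (x + (1 / real (Suc n)) *\<^sub>R v) \<ge> norm x - norm ((1 / real (Suc n)) *\<^sub>R v)"
      by (rule norm_diff_ineq)
    moreover have "norm ((1 / real (Suc n)) *\<^sub>R v) \<le> norm v"
      by (simp add: divide_le_eq mult_le_cancel_left1)
    ultimately have "norm (x + (1 / real (Suc n)) *\<^sub>R v) > R" using False by linarith
    moreover have "norm x > R" using False norm_ge_zero[of v] by linarith
    ultimately have "G n x = 0" by (simp add: G_def supp)
    then show ?thesis using M(1) by simp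
  qed
  have w: "integrable lborel (\<lambda>x. M * indicator (cball 0 (R + norm v)) x :: real)"
    by (intro integrable_mult_right integrable_real_indicator emeasure_bounded_finite bounded_cball) simp
  have meas: "(\<lambda>x. D x v) \<in> borel_measurable lborel"
    using borel_measurable_continuous_onI[OF contD] by simp
  have AE: "AE x in lborel. (\<lambda>n. G n x) \<longlonglongrightarrow> D x v"
    "\<And>n. AE x in lborel. norm (G n x) \<le> M * indicator (cball 0 (R + norm v)) x"
    using lim bound by auto
  show "integrable lborel (\<lambda>x. frechet_derivative F (at x) v)"
    using integrable_dominated_convergence[OF meas _ w AE] intG(1) unfolding D_def by auto
  have "(\<lambda>n. integral\<^sup>L lborel (G n)) \<longlonglongrightarrow> (\<integral>x. D x v \<partial>lborel)"
    by (rule integral_dominated_convergence[OF meas _ w AE]) (use intG(1) in auto)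
  then show "(\<integral>x. frechet_derivative F (at x) v \<partial>lborel) = 0"
    unfolding intG(2) D_def by (simp add: LIMSEQ_const_iff)
qed

text \<open>Integration by parts: each integrand is a sum of directional derivatives of compactly
  supported \<open>C^1\<close> products such as \<open>u x $ i * u x $ j * \<zeta> x\<close>,
  because the terms in which \<open>\<zeta>\<close> is not differentiated cancel by the
  equations.\<close>

lemma classical_imp_distributional_euler:
  assumes u: "Ck_on 1 UNIV u" and p: "Ck_on 1 UNIV p" and euler: "classical_euler_on UNIV u p"
  shows "distributional_euler u p"
  unfolding distributional_euler_def
proof (intro conjI allI impI)
  show "continuous_on UNIV u" "continuous_on UNIV p"
    using Ck_on_le[OF u, of 0] Ck_on_le[OF p, of 0] by simp_all
  fix \<zeta> :: "real ^ 2 \<Rightarrow> real" assume "test_function \<zeta>"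
  then have \<zeta>: "Ck_on 1 UNIV \<zeta>" and "compact (closure {x. \<zeta> x \<noteq> 0})"
    unfolding test_function_def by blast+
  then have "bounded {x. \<zeta> x \<noteq> 0}"
    using bounded_subset[OF compact_imp_bounded closure_subset] by blast
  then obtain R where R: "\<And>x. \<zeta> x \<noteq> 0 \<Longrightarrow> norm x \<le> R"
    unfolding bounded_iff by blast
  have supp: "f x * \<zeta> x = 0" if "norm x > R" for x and f :: "real ^ 2 \<Rightarrow> real"
    using R[of x] that by fastforce
  define Du where "Du x = frechet_derivative u (at x)" for x
  define Dp where "Dp x = frechet_derivative p (at x)" for x
  define D\<zeta> where "D\<zeta> x = frechet_derivative \<zeta> (at x)" for x
  have Du: "(u has_derivative Du x) (at x)" and Dp: "(p has_derivative Dp x) (at x)"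
    and D\<zeta>: "(\<zeta> has_derivative D\<zeta> x) (at x)" for x
    unfolding Du_def Dp_def D\<zeta>_def using u p \<zeta> Ck_on_1_has_derivative[of UNIV _ x] by blast+
  have mom: "u x $ 1 * Du x (axis 1 1) $ j + u x $ 2 * Du x (axis 2 1) $ j + Dp x (axis j 1) = 0"
    and div: "Du x (axis 1 1) $ 1 + Du x (axis 2 1) $ 2 = 0" for x j
  proof -
    have "Du x (u x) $ j + Dp x (axis j 1) = 0" "Du x (axis 1 1) $ 1 + Du x (axis 2 1) $ 2 = 0"
      using euler classical_euler_on_iff[of UNIV u Du p Dp] Du Dp by auto
    then show "u x $ 1 * Du x (axis 1 1) $ j + u x $ 2 * Du x (axis 2 1) $ j + Dp x (axis j 1) = 0"
      "Du x (axis 1 1) $ 1 + Du x (axis 2 1) $ 2 = 0"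
      using linear_real2[OF has_derivative_linear[OF Du[of x]], of "u x"] by simp_all
  qed
  have ui: "Ck_on 1 UNIV (\<lambda>x. u x $ i)" for i
  proof (unfold One_nat_def, rule Ck_on_SucI)
    show "((\<lambda>x. u x $ i) has_derivative (\<lambda>v. Du x v $ i)) (at x)" for x
      by (rule bounded_linear.has_derivative[OF bounded_linear_vec_nth Du])
    show "Ck_on 0 UNIV (\<lambda>x. Du x v $ i)" for v
      using u by (simp add: Du_def continuous_on_component)
  qed auto
  have dui: "((\<lambda>x. u x $ i) has_derivative (\<lambda>v. Du x v $ i)) (at x)" for x i
    by (rule bounded_linear.has_derivative[OF bounded_linear_vec_nth Du])
  have zero: "integrable lborel (\<lambda>x. D x v)" "(\<integral>x. D x v \<partial>lborel) = 0"
    if "Ck_on 1 UNIV f" "\<And>x. ((\<lambda>x. f x * \<zeta> x) has_derivative D x) (at x)"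
    for f :: "real ^ 2 \<Rightarrow> real" and D v
  proof -
    have "frechet_derivative (\<lambda>x. f x * \<zeta> x) (at x) = D x" for x
      using frechet_derivative_at[OF that(2)] by simp
    moreover have "Ck_on 1 UNIV (\<lambda>x. f x * \<zeta> x)"
      by (intro Ck_on_mult that \<zeta>) auto
    ultimately show "integrable lborel (\<lambda>x. D x v)" "(\<integral>x. D x v \<partial>lborel) = 0"
      using integral_directional_derivative_zero[of "\<lambda>x. f x * \<zeta> x" R v] supp by simp_all
  qed
  have pd: "partial_deriv i \<zeta> x = D\<zeta> x (axis i 1)" for i x
    by (rule partial_deriv_eq[OF D\<zeta>])
  show "(\<integral>x. (\<Sum>i\<in>UNIV. u x $ i * partial_deriv i \<zeta> x) \<partial>lborel) = 0"
  proof -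
    define E where "E i x v = u x $ i * D\<zeta> x v + Du x v $ i * \<zeta> x" for i x v
    have E: "((\<lambda>x. u x $ i * \<zeta> x) has_derivative E i x) (at x)" for i x
      unfolding E_def by (intro has_derivative_mult dui D\<zeta>)
    have "(\<Sum>i\<in>UNIV. u x $ i * partial_deriv i \<zeta> x) = E 1 x (axis 1 1) + E 2 x (axis 2 1)" for x
      using div[of x] unfolding sum_2 pd E_def by algebra
    then show ?thesis
      by (simp add: zero[OF ui E] Bochner_Integration.integral_add)
  qed
  fix j
  define E where "E i x v = u x $ i * u x $ j * D\<zeta> x v + (u x $ i * Du x v $ j + Du x v $ i * u x $ j) * \<zeta> x" for i x v
  have E: "((\<lambda>x. u x $ i * u x $ j * \<zeta> x) has_derivative E i x) (at x)" for i x
    unfolding E_def by (intro has_derivative_mult dui D\<zeta>)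
  define P where "P x v = p x * D\<zeta> x v + Dp x v * \<zeta> x" for x v
  have P: "((\<lambda>x. p x * \<zeta> x) has_derivative P x) (at x)" for x
    unfolding P_def by (intro has_derivative_mult Dp D\<zeta>)
  have uu: "Ck_on 1 UNIV (\<lambda>x. u x $ i * u x $ j)" for i by (intro Ck_on_mult ui) auto
  \<comment> \<open>The undifferentiated \<open>\<zeta> x\<close> is multiplied by the momentum
    equation plus \<open>u x $ j\<close> times the divergence, hence by zero.\<close>
  have "(\<Sum>i\<in>UNIV. u x $ i * u x $ j * partial_deriv i \<zeta> x) + p x * partial_deriv j \<zeta> x
      = E 1 x (axis 1 1) + E 2 x (axis 2 1) + P x (axis j 1)" for x
    using div[of x] mom[of x j] unfolding sum_2 pd E_def P_def by algebra
  then show "(\<integral>x. (\<Sum>i\<in>UNIV. u x $ i * u x $ j * partial_deriv i \<zeta> x) + p x * partial_deriv j \<zeta> x \<partial>lborel) = 0"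
    by (simp add: zero[OF uu E] zero[OF p P] Bochner_Integration.integral_add)
qed

section \<open>Existence of solutions and assembly of the four cases\<close>

lemma exists_homogeneous_solution:
  assumes "\<bar>\<alpha>\<bar> > 1"
  shows "\<exists>u c. Ck_on (if \<alpha> > 1 then 2 else 1) punctured_plane u \<and>
    classical_euler_on punctured_plane u (\<lambda>x. c * norm x powr (- 2 * \<alpha>)) \<and>
    (\<forall>S. admissible_on \<alpha> S u (\<lambda>x. c * norm x powr (- 2 * \<alpha>))) \<and> u 0 = 0"
proof (rule exists_angular_profile[OF assms])
  fix U V U' :: "real \<Rightarrow> real" and c t
  assume profile: "\<And>t. U (t + 2 * pi) = U t" "\<And>t. V (t + 2 * pi) = V t"
    "\<And>t. U (- t) = U t" "\<And>t. V (- t) = - V t"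
    "\<And>t. (U has_real_derivative U' t) (at t)"
    "\<And>t. (V has_real_derivative (\<alpha> - 1) * U t) (at t)"
    "\<And>t. V t * U' t = \<alpha> * (U t)\<^sup>2 + (V t)\<^sup>2 + 2 * \<alpha> * c"
    "(1 - \<alpha>) * V t \<noteq> U' t"
    and Ck: "Ck_on (if \<alpha> > 1 then 2 else 1) UNIV U" "Ck_on (if \<alpha> > 1 then 2 else 1) UNIV V"
  show ?thesis
    by (intro exI[of _ "polar_field \<alpha> U V"] exI[of _ c] conjI allI
        Ck_on_polar_field[OF Ck profile(1,2)] polar_field_system(1)[OF profile(1,2,5-7)]
        admissible_polar_field[OF profile] polar_field_zero)
qed

theorem theorem1p7:
  fixes \<alpha> :: real
  shows
    "(0 \<le> \<alpha> \<and> \<alpha> \<le> 1 \<longrightarrow>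
        \<not> (\<exists>u p. Ck_on 1 punctured_plane u \<and> classical_euler_on punctured_plane u p \<and>
                 admissible_on \<alpha> punctured_plane u p)) \<and>
     (- 1 \<le> \<alpha> \<and> \<alpha> < 0 \<longrightarrow>
        \<not> (\<exists>u p. Ck_on 2 punctured_plane u \<and> classical_euler_on punctured_plane u p \<and>
                 admissible_on \<alpha> punctured_plane u p)) \<and>
     (1 < \<alpha> \<longrightarrow>
        (\<exists>u p. Ck_on 2 punctured_plane u \<and> classical_euler_on punctured_plane u p \<and>
               admissible_on \<alpha> punctured_plane u p)) \<and>
     (\<alpha> < - 1 \<longrightarrow>
        (\<exists>u p. Ck_on 1 punctured_plane u \<and> continuous_on UNIV u \<and>
               classical_euler_on punctured_plane u p \<and> distributional_euler u p \<and>
               admissible_on \<alpha> UNIV u p))"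
proof (intro conjI impI)
  assume \<alpha>: "0 \<le> \<alpha> \<and> \<alpha> \<le> 1"
  show "\<not> (\<exists>u p. Ck_on 1 punctured_plane u \<and> classical_euler_on punctured_plane u p \<and>
      admissible_on \<alpha> punctured_plane u p)"
  proof clarify
    fix u p assume "Ck_on 1 punctured_plane u" "classical_euler_on punctured_plane u p"
      "admissible_on \<alpha> punctured_plane u p"
    then show False by (rule admissible_imp_not_small_exponent) (use \<alpha> in auto)
  qed
next
  assume \<alpha>: "- 1 \<le> \<alpha> \<and> \<alpha> < 0"
  show "\<not> (\<exists>u p. Ck_on 2 punctured_plane u \<and> classical_euler_on punctured_plane u p \<and>
      admissible_on \<alpha> punctured_plane u p)"
  proof clarify
    fix u p assume C2: "Ck_on 2 punctured_plane u" and *: "classical_euler_on punctured_plane u p"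
      "admissible_on \<alpha> punctured_plane u p"
    have "Ck_on 1 punctured_plane u" by (rule Ck_on_le[OF C2]) simp
    from this * show False by (rule admissible_imp_not_small_exponent) (use \<alpha> C2 in auto)
  qed
next
  assume "1 < \<alpha>"
  then show "\<exists>u p. Ck_on 2 punctured_plane u \<and> classical_euler_on punctured_plane u p \<and>
      admissible_on \<alpha> punctured_plane u p"
    using exists_homogeneous_solution[of \<alpha>] by auto
next
  assume \<alpha>: "\<alpha> < - 1"
  then have "\<bar>\<alpha>\<bar> > 1" "\<not> \<alpha> > 1" by auto
  then obtain u c where C1: "Ck_on 1 punctured_plane u"
    and euler': "classical_euler_on punctured_plane u (\<lambda>x. c * norm x powr (- 2 * \<alpha>))"
    and adm': "\<And>S. admissible_on \<alpha> S u (\<lambda>x. c * norm x powr (- 2 * \<alpha>))" and u0: "u 0 = 0"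
    using exists_homogeneous_solution[of \<alpha>] by (simp only: if_False) blast
  define p where "p x = c * norm x powr (- 2 * \<alpha>)" for x :: "real ^ 2"
  have euler: "classical_euler_on punctured_plane u p" and adm: "admissible_on \<alpha> S u p" for S
    using euler' adm' by (simp_all only: p_def[abs_def])
  have hom: "u (l *\<^sub>R x) = l powr - \<alpha> *\<^sub>R u x" "p (l *\<^sub>R x) = l powr (- 2 * \<alpha>) *\<^sub>R p x"
    if "l > 0" for x l
  proof -
    have "u x = l powr \<alpha> *\<^sub>R u (l *\<^sub>R x)"
      using adm[of UNIV] that unfolding admissible_on_def homogeneous_on_def by blast
    then show "u (l *\<^sub>R x) = l powr - \<alpha> *\<^sub>R u x" using that by (simp add: powr_minus)
    show "p (l *\<^sub>R x) = l powr (- 2 * \<alpha>) *\<^sub>R p x"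
      using that by (simp add: p_def powr_mult)
  qed
  have C1p: "Ck_on 1 punctured_plane p"
    unfolding p_def[abs_def] by (intro Ck_on_mult Ck_on_const Ck_on_norm_powr) auto
  have p0: "p 0 = 0" by (simp add: p_def)
  have cont: "continuous_on punctured_plane u" "continuous_on punctured_plane p"
    using Ck_on_le[OF C1, of 0] Ck_on_le[OF C1p, of 0] by simp_all
  \<comment> \<open>Velocity and pressure have degrees \<open>- \<alpha>\<close> and
    \<open>- 2 * \<alpha>\<close>, both above \<open>1\<close> when
    \<open>\<alpha> < - 1\<close>.\<close>
  have du0: "(u has_derivative (\<lambda>_. 0)) (at 0)"
    by (rule homogeneous_has_derivative_zero[OF cont(1) u0 _ hom(1)]) (use \<alpha> in auto)
  have dp0: "(p has_derivative (\<lambda>_. 0)) (at 0)"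
    by (rule homogeneous_has_derivative_zero[OF cont(2) p0 _ hom(2)]) (use \<alpha> in auto)
  have u: "Ck_on 1 UNIV u"
    by (rule Ck_on_homogeneous_UNIV[OF C1 u0 _ hom(1)]) (use \<alpha> in auto)
  have p: "Ck_on 1 UNIV p"
    by (rule Ck_on_homogeneous_UNIV[OF C1p p0 _ hom(2)]) (use \<alpha> in auto)
  \<comment> \<open>All first derivatives vanish at the origin, so the equations hold there and the
    pair is a classical solution on the whole plane.\<close>
  have "classical_euler_on {0} u p"
    by (subst classical_euler_on_iff[of _ _ "\<lambda>_ _. 0" _ "\<lambda>_ _. 0"]) (auto simp: du0 dp0)
  with euler have "classical_euler_on UNIV u p"
    unfolding classical_euler_on_def by blast
  with u p have "distributional_euler u p" by (intro classical_imp_distributional_euler)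
  moreover have "continuous_on UNIV u" using Ck_on_le[OF u, of 0] by simp
  ultimately show "\<exists>u p. Ck_on 1 punctured_plane u \<and> continuous_on UNIV u \<and>
      classical_euler_on punctured_plane u p \<and> distributional_euler u p \<and> admissible_on \<alpha> UNIV u p"
    using C1 euler adm by blast
qed

end
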